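(* Let $f:\mathbb{R}^{d\times N}\to\overline{\mathbb{R}}$ be a level convex Borel function such that for every $\lambda>\inf_{\mathbb{R}^{d\times N}}f$ the sublevel set $L_\lambda(f)=\{\xi\in\mathbb{R}^{d\times N}:f(\xi)\le\lambda\}$ is convex and has nonempty interior. Then $f^{ls}$ is the greatest strong Morrey quasiconvex function less than or equal to $f$.
   Context: $\overline{\mathbb{R}}=[-\infty,+\infty]$; $\lambda$ ranges over real numbers. $f$ is level convex if $L_\lambda(f)$ is convex for every $\lambda\in\mathbb{R}$. $f^{ls}:\mathbb{R}^{d\times N}\to\overline{\mathbb{R}}$ is the lower semicontinuous envelope of $f$, i.e. the greatest lower semicontinuous function $\le f$. Let $Q:=]0,1[^N$. A Borel function $g:\mathbb{R}^{d\times N}\to\mathbb{R}$ is strong Morrey quasiconvex if for every $\varepsilon>0$, $\xi\in\mathbb{R}^{d\times N}$ and $K>0$ there exists $\delta=\delta(\varepsilon,K,\xi)>0$ such that, whenever $\varphi\in W^{1,\infty}(Q;\mathbb{R}^d)$ satisfies $\|\nabla\varphi\|_{L^\infty(Q)}\le K$ and $\max_{x\in\partial Q}|\varphi(x)|\le\delta$, one has $g(\xi)\le\operatorname*{ess\,sup}_{x\in Q}g(\xi+\nabla\varphi(x))+\varepsilon$. A Borel function $g:\mathbb{R}^{d\times N}\to\overline{\mathbb{R}}$ is called strong Morrey quasiconvex if the real-valued function $\arctan\circ g$ is (with $\arctan(\pm\infty)=\pm\pi/2$); for real-valued $g$ this agrees with the previous definition when both apply. "Greatest" is understood among all strong Morrey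 quasiconvex functions $\mathbb{R}^{d\times N}\to\overline{\mathbb{R}}$. *)

theory Defs
  imports "HOL-Analysis.Analysis" "HOL-Probability.Essential_Supremum"
begin

text \<open>A matrix in \<open>\<real>\<^sup>d\<^sup>\<times>\<^sup>N\<close> is an element of \<open>real ^ 'n ^ 'd\<close>: row index in \<open>'d\<close>, column index
  in \<open>'n\<close>. The norm of this type is the Frobenius norm.\<close>

subsection \<open>Level convexity and lower semicontinuity\<close>

definition sublevel :: "('a \<Rightarrow> ereal) \<Rightarrow> real \<Rightarrow> 'a set"
  where "sublevel f l = {x. f x \<le> ereal l}"

definition level_convex :: "('a::real_vector \<Rightarrow> ereal) \<Rightarrow> bool"
  where "level_convex f \<longleftrightarrow> (\<forall>l::real. convex (sublevel f l))"

definition lsc :: "('a::topological_space \<Rightarrow> ereal) \<Rightarrow> bool"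
  where "lsc f \<longleftrightarrow> (\<forall>x. f x \<le> Liminf (at x) f)"

definition lsc_envelope :: "('a::topological_space \<Rightarrow> ereal) \<Rightarrow> 'a \<Rightarrow> ereal"
  where "lsc_envelope f = (GREATEST h. lsc h \<and> h \<le> f)"

text \<open>The greatest element selected in the definition always exists: it is the pointwise supremum
  of the lower semicontinuous minorants.\<close>

lemma lsc_envelope_eq_SUP: "lsc_envelope f = (\<lambda>x. SUP h\<in>{h. lsc h \<and> h \<le> f}. h x)"
  and lsc_lsc_envelope: "lsc (lsc_envelope f)"
  and lsc_envelope_le: "lsc_envelope f \<le> f"
  and lsc_envelope_greatest: "lsc h \<Longrightarrow> h \<le> f \<Longrightarrow> h \<le> lsc_envelope f"
proof -
  let ?H = "{h. lsc h \<and> h \<le> f}"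
  let ?s = "\<lambda>x. SUP h\<in>?H. h x"
  have "?s x \<le> Liminf (at x) ?s" for x
  proof (rule SUP_least)
    fix h assume h: "h \<in> ?H"
    then have "h x \<le> Liminf (at x) h" by (simp add: lsc_def)
    also have "\<dots> \<le> Liminf (at x) ?s"
      by (intro Liminf_mono always_eventually allI SUP_upper h)
    finally show "h x \<le> Liminf (at x) ?s" .
  qed
  then have lsc_s: "lsc ?s" unfolding lsc_def by blast
  have le: "?s \<le> f" by (auto simp: le_fun_def intro!: SUP_least)
  have gr: "h \<le> ?s" if "lsc h" "h \<le> f" for h
    using that by (auto simp: le_fun_def intro!: SUP_upper)
  show eq: "lsc_envelope f = ?s"
    unfolding lsc_envelope_def by (rule Greatest_equality) (use lsc_s le gr in auto)
  show "lsc (lsc_envelope f)" "lsc_envelope f \<le> f" "lsc h \<Longrightarrow> h \<le> f \<Longrightarrow> h \<le> lsc_envelope f"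
    using lsc_s le gr by (simp_all add: eq)
qed

subsection \<open>The Sobolev space \<open>W\<^sup>1\<^sup>,\<^sup>\<infinity>\<close>\<close>

definition partial :: "'n \<Rightarrow> (real ^ 'n \<Rightarrow> real) \<Rightarrow> real ^ 'n::finite \<Rightarrow> real"
  where "partial j \<psi> x = frechet_derivative \<psi> (at x) (axis j 1)"

text \<open>\<open>C\<^sup>\<infinity>\<close> on the whole space: every iterated partial derivative is again (Frechet) differentiable
  everywhere, which makes all of them continuous.\<close>

definition smooth :: "(real ^ 'n::finite \<Rightarrow> real) \<Rightarrow> bool"
  where "smooth \<psi> \<longleftrightarrow> (\<forall>js x. foldr partial js \<psi> differentiable (at x))"

definition test_functions :: "(real ^ 'n) set \<Rightarrow> (real ^ 'n::finite \<Rightarrow> real) set"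
  where "test_functions \<Omega> =
    {\<psi>. smooth \<psi> \<and> compact (closure {x. \<psi> x \<noteq> 0}) \<and> closure {x. \<psi> x \<noteq> 0} \<subseteq> \<Omega>}"

definition Linf_norm :: "(real ^ 'n) set \<Rightarrow> (real ^ 'n::finite \<Rightarrow> 'b::real_normed_vector) \<Rightarrow> ereal"
  where "Linf_norm \<Omega> u = esssup (lebesgue_on \<Omega>) (\<lambda>x. ereal (norm (u x)))"

definition Linf :: "(real ^ 'n) set \<Rightarrow> (real ^ 'n::finite \<Rightarrow> 'b::real_normed_vector) set"
  where "Linf \<Omega> = {u \<in> borel_measurable (lebesgue_on \<Omega>). Linf_norm \<Omega> u < \<infinity>}"

text \<open>\<open>W1inf \<Omega> \<phi> G\<close>: \<open>\<phi>\<close> belongs to \<open>W\<^sup>1\<^sup>,\<^sup>\<infinity>(\<Omega>; \<real>\<^sup>d)\<close> and \<open>G\<close> is (a representative of) its weak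
  gradient, with \<open>G x $ i $ j\<close> the derivative of the \<open>i\<close>-th component in direction \<open>j\<close>.\<close>

definition W1inf ::
    "(real ^ 'n) set \<Rightarrow> (real ^ 'n \<Rightarrow> real ^ 'd) \<Rightarrow> (real ^ 'n::finite \<Rightarrow> real ^ 'n ^ 'd::finite) \<Rightarrow> bool"
  where "W1inf \<Omega> \<phi> G \<longleftrightarrow> \<phi> \<in> Linf \<Omega> \<and> G \<in> Linf \<Omega> \<and>
    (\<forall>\<psi>\<in>test_functions \<Omega>. \<forall>i j.
      (LINT x|lebesgue_on \<Omega>. \<phi> x $ i * partial j \<psi> x) = - (LINT x|lebesgue_on \<Omega>. G x $ i $ j * \<psi> x))"

subsection \<open>Strong Morrey quasiconvexity\<close>

abbreviation unit_cube :: "(real ^ 'n::finite) set"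
  where "unit_cube \<equiv> box 0 1"

text \<open>Every class in \<open>W\<^sup>1\<^sup>,\<^sup>\<infinity>(Q; \<real>\<^sup>d)\<close> has exactly one representative on the closure of the cube \<open>Q\<close>
  that is continuous there, and its boundary values are those of that representative. Hence \<open>\<phi>\<close>
  below ranges over functions continuous on the closed cube. The essential supremum is taken in
  the extended reals because it may be infinite.\<close>

definition strong_Morrey_quasiconvex_real :: "(real ^ 'n::finite ^ 'd::finite \<Rightarrow> real) \<Rightarrow> bool"
  where "strong_Morrey_quasiconvex_real g \<longleftrightarrow> g \<in> borel_measurable borel \<and>
    (\<forall>\<epsilon>>0. \<forall>\<xi>. \<forall>K>0. \<exists>\<delta>>0. \<forall>\<phi> G.
      W1inf unit_cube \<phi> G \<longrightarrow> continuous_on (closure unit_cube) \<phi> \<longrightarrow>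
      Linf_norm unit_cube G \<le> ereal K \<longrightarrow> (\<forall>x\<in>frontier unit_cube. norm (\<phi> x) \<le> \<delta>) \<longrightarrow>
      ereal (g \<xi>) \<le> esssup (lebesgue_on unit_cube) (\<lambda>x. ereal (g (\<xi> + G x))) + ereal \<epsilon>)"

definition arctan_ereal :: "ereal \<Rightarrow> real"
  where "arctan_ereal x =
    (if x = \<infinity> then pi / 2 else if x = - \<infinity> then - (pi / 2) else arctan (real_of_ereal x))"

definition strong_Morrey_quasiconvex :: "(real ^ 'n::finite ^ 'd::finite \<Rightarrow> ereal) \<Rightarrow> bool"
  where "strong_Morrey_quasiconvex g \<longleftrightarrow> g \<in> borel_measurable borel \<and>
    strong_Morrey_quasiconvex_real (\<lambda>\<xi>. arctan_ereal (g \<xi>))"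

end

theory Submission
  imports Defs "HOL-Computational_Algebra.Polynomial" "HOL-Probability.Probability_Measure"
begin

text \<open>Strong Morrey quasiconvexity forces lower semicontinuity: a linear map with small matrix \<open>A\<close> has
  small boundary values, so testing with it compares \<open>g \<xi>\<close> with \<open>g (\<xi> + A)\<close>. Hence every strong Morrey
  quasiconvex \<open>g \<le> f\<close> lies below the lower semicontinuous envelope.

  Conversely, the sublevel sets of the envelope of a level convex function are intersections of
  closures of sublevel sets of \<open>f\<close>, hence closed and convex. If \<open>\<phi>\<close> is small on the boundary of the cube,
  testing its weak gradient against cutoff functions whose derivatives live near the faces shows that
  the mean of \<open>\<nabla>\<phi>\<close> is small. The mean of \<open>\<xi> + \<nabla>\<phi>\<close> lies in every closed convex set that contains almost
  all values of \<open>\<xi> + \<nabla>\<phi>\<close>, and lower semicontinuity at \<open>\<xi>\<close> gives the claim.\<close>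

subsection \<open>Level sets of the lower semicontinuous envelope\<close>

text \<open>The lower limit in \<open>lsc\<close> is taken over punctured neighbourhoods; at the
  point itself \<open>y < f x\<close> is already known, so a full neighbourhood lies in the strict
  superlevel set. This form yields closed sublevel sets and Borel measurability.\<close>

lemma lsc_iff_open: "lsc f \<longleftrightarrow> (\<forall>y. open {x. y < f x})"
proof
  assume f: "lsc f"
  show "\<forall>y. open {x. y < f x}"
  proof
    fix y
    have "\<forall>\<^sub>F z in nhds x. z \<in> {x. y < f x}" if "y < f x" for x
    proof -
      have "y < Liminf (at x) f" using f that unfolding lsc_def by (metis less_le_trans)
      then have "\<forall>\<^sub>F z in at x. y < f z" by (rule less_LiminfD)
      then show ?thesis
        unfolding eventually_at_filter by eventually_elim (use that in auto)
    qed
    then show "open {x. y < f x}" by (subst open_subopen) (fastforce simp: eventually_nhds)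
  qed
next
  assume op: "\<forall>y. open {x. y < f x}"
  show "lsc f"
    unfolding lsc_def le_Liminf_iff
  proof (intro allI impI)
    fix x y assume "y < f x"
    then have "\<forall>\<^sub>F z in nhds x. z \<in> {x. y < f x}" using op by (intro eventually_nhds_in_open) auto
    then show "\<forall>\<^sub>F z in at x. y < f z" unfolding eventually_at_filter by eventually_elim auto
  qed
qed

lemma lsc_imp_closed_le: "lsc f \<Longrightarrow> closed {x. f x \<le> y}"
  unfolding lsc_iff_open closed_def by (simp add: Collect_neg_eq[symmetric] not_le)

text \<open>Each sublevel set of the envelope is closed and contains that of \<open>f\<close>, hence
  its closure; conversely a step function built on a closed sublevel set bounds the envelope from
  below. Levels \<open>m\<close> strictly above \<open>y\<close> are used because the closure of the
  sublevel set at level \<open>y\<close> itself may miss points where the envelope equals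
  \<open>y\<close>.\<close>

lemma lsc_envelope_le_eq:
  "{x. lsc_envelope f x \<le> y} = (\<Inter>m\<in>{m::real. y < ereal m}. closure (sublevel f m))"
proof (intro equalityI subsetI)
  fix x assume x: "x \<in> {x. lsc_envelope f x \<le> y}"
  show "x \<in> (\<Inter>m\<in>{m::real. y < ereal m}. closure (sublevel f m))"
  proof (rule ccontr)
    assume "\<not> ?thesis"
    then obtain m where m: "y < ereal m" "x \<notin> closure (sublevel f m)" by auto
    \<comment> \<open>This step function is lower semicontinuous because its small value is taken on
      a closed set, and it stays below \<open>f\<close> because \<open>f\<close> exceeds
      \<open>m\<close> off that set.\<close>
    let ?h = "\<lambda>x. if x \<in> closure (sublevel f m) then -\<infinity> else ereal m"
    have "{x. z < ?h x} = (if z < ereal m then - closure (sublevel f m) else {})" for z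
      using m by auto
    then have "lsc ?h" unfolding lsc_iff_open by (auto simp: open_Compl)
    moreover have "ereal m \<le> f x" if "x \<notin> closure (sublevel f m)" for x
      using that closure_subset[of "sublevel f m"] by (force simp: sublevel_def)
    then have "?h \<le> f" by (auto simp: le_fun_def)
    ultimately have "?h \<le> lsc_envelope f" by (rule lsc_envelope_greatest)
    then have "ereal m \<le> lsc_envelope f x" using m(2) by (auto simp: le_fun_def dest: spec[of _ x])
    then show False using x m(1) by auto
  qed
next
  fix x assume x: "x \<in> (\<Inter>m\<in>{m::real. y < ereal m}. closure (sublevel f m))"
  have "lsc_envelope f x \<le> ereal m" if "y < ereal m" for m
  proof -
    have "closure (sublevel f m) \<subseteq> {x. lsc_envelope f x \<le> ereal m}"
      using lsc_envelope_le[of f]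
      by (intro closure_minimal lsc_imp_closed_le lsc_lsc_envelope)
        (auto simp: sublevel_def le_fun_def intro: order_trans)
    then show ?thesis using x that by auto
  qed
  then have "lsc_envelope f x \<le> y" by (metis ereal_dense2 leD leI)
  then show "x \<in> {x. lsc_envelope f x \<le> y}" by simp
qed

lemma convex_lsc_envelope_le:
  fixes f :: "'a::real_normed_vector \<Rightarrow> ereal"
  assumes "level_convex f"
  shows "convex {x. lsc_envelope f x \<le> y}"
  unfolding lsc_envelope_le_eq
  using assms by (intro convex_INT convex_closure) (auto simp: level_convex_def)

section \<open>Arctangent as an order isomorphism of the extended reals onto a compact
  interval\<close>

lemma arctan_ereal_bounds: "- (pi / 2) \<le> arctan_ereal x" "arctan_ereal x \<le> pi / 2"
  using arctan_lbound arctan_ubound by (auto simp: arctan_ereal_def less_imp_le)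

lemma arctan_ereal_less_iff: "arctan_ereal x < arctan_ereal y \<longleftrightarrow> x < y"
  using arctan_lbound arctan_ubound
  by (cases x; cases y) (auto simp: arctan_ereal_def arctan_less_iff not_less less_imp_le intro: order_less_trans)

lemma arctan_ereal_le_iff: "arctan_ereal x \<le> arctan_ereal y \<longleftrightarrow> x \<le> y"
  using arctan_ereal_less_iff[of y x] by (simp add: not_less[symmetric])

lemma arctan_ereal_surj:
  assumes "- (pi / 2) \<le> c" "c \<le> pi / 2"
  obtains y where "arctan_ereal y = c"
proof (cases "c = - (pi / 2) \<or> c = pi / 2")
  case True
  then show ?thesis using that[of "\<infinity>"] that[of "-\<infinity>"] by (auto simp: arctan_ereal_def)
next
  case False
  then show ?thesis using that[of "ereal (tan c)"] assms by (simp add: arctan_ereal_def arctan_tan)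
qed

text \<open>Composition with an increasing bijection onto the interval from
  \<open>- (pi / 2)\<close> to \<open>pi / 2\<close> only relabels the levels; levels outside the
  interval give nothing or everything. Closedness and convexity of sublevel sets therefore pass to
  the composition. The level \<open>c\<close> is extended real since it will be an essential
  supremum.\<close>

lemma arctan_ereal_sublevel_cases:
  "{x. ereal (arctan_ereal (F x)) \<le> c} \<in> {{}, UNIV} \<union> range (\<lambda>y. {x. F x \<le> y})"
proof -
  consider "c < ereal (- (pi / 2))" | "ereal (pi / 2) \<le> c"
    | r where "c = ereal r" "- (pi / 2) \<le> r" "r \<le> pi / 2"
    by (cases c) (force simp: not_less)+
  then show ?thesis
  proof cases
    case 1
    have "c < ereal (arctan_ereal (F x))" for x
      using 1 arctan_ereal_bounds(1)[of "F x"] by (metis ereal_less_eq(3) less_le_trans)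
    then have "{x. ereal (arctan_ereal (F x)) \<le> c} = {}" by (auto simp: not_le)
    then show ?thesis by simp
  next
    case 2
    have "ereal (arctan_ereal (F x)) \<le> c" for x
      using 2 arctan_ereal_bounds(2)[of "F x"] by (metis ereal_less_eq(3) order_trans)
    then have "{x. ereal (arctan_ereal (F x)) \<le> c} = UNIV" by auto
    then show ?thesis by simp
  next
    case 3
    obtain y where "arctan_ereal y = r" using arctan_ereal_surj 3 by blast
    then have "{x. ereal (arctan_ereal (F x)) \<le> c} = {x. F x \<le> y}"
      using 3 arctan_ereal_le_iff by auto
    then show ?thesis by auto
  qed
qed

subsection \<open>Smooth cutoff functions\<close>

text \<open>Infinite differentiability, witnessed by the whole sequence of derivatives, so that each
  closure property below amounts to writing down a new sequence.\<close>

definition smooth_line :: "(real \<Rightarrow> real) \<Rightarrow> bool"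
  where "smooth_line b \<longleftrightarrow>
    (\<exists>F. F 0 = b \<and> (\<forall>n x. (F n has_real_derivative F (Suc n) x) (at x)))"

lemma smooth_line_deriv:
  assumes "smooth_line b"
  obtains b' where "smooth_line b'" "\<And>x. (b has_real_derivative b' x) (at x)"
proof -
  obtain F where "F 0 = b" and F: "\<And>n x. (F n has_real_derivative F (Suc n) x) (at x)"
    using assms unfolding smooth_line_def by blast
  then have "smooth_line (F 1)"
    unfolding smooth_line_def by (intro exI[of _ "\<lambda>n. F (Suc n)"]) auto
  then show ?thesis using that F[of 0] \<open>F 0 = b\<close> by auto
qed

lemma smooth_lineI:
  assumes "smooth_line b'" "\<And>x. (b has_real_derivative b' x) (at x)"
  shows "smooth_line b"
proof -
  obtain F where F: "F 0 = b'" "\<And>n x. (F n has_real_derivative F (Suc n) x) (at x)"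
    using assms(1) unfolding smooth_line_def by blast
  have "\<forall>n x. (case_nat b F n has_real_derivative case_nat b F (Suc n) x) (at x)"
    using F assms(2) by (auto split: nat.split)
  then show ?thesis
    unfolding smooth_line_def by (intro exI[of _ "case_nat b F"]) auto
qed

lemma smooth_line_diff:
  assumes "smooth_line f" "smooth_line g"
  shows "smooth_line (\<lambda>x. f x - g x)"
proof -
  obtain F G where "F 0 = f" "\<And>n x. (F n has_real_derivative F (Suc n) x) (at x)"
    "G 0 = g" "\<And>n x. (G n has_real_derivative G (Suc n) x) (at x)"
    using assms unfolding smooth_line_def by metis
  then show ?thesis
    unfolding smooth_line_def
    by (intro exI[of _ "\<lambda>n x. F n x - G n x"]) (auto intro!: DERIV_diff)
qed

lemma smooth_line_affine:
  assumes "smooth_line f"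
  shows "smooth_line (\<lambda>x. c * f (p * x + q))"
proof -
  obtain F where F: "F 0 = f" "\<And>n x. (F n has_real_derivative F (Suc n) x) (at x)"
    using assms unfolding smooth_line_def by metis
  have "((\<lambda>x. c * p ^ n * F n (p * x + q)) has_real_derivative
      c * p ^ Suc n * F (Suc n) (p * x + q)) (at x)" for n x
    by (auto intro!: derivative_eq_intros DERIV_chain2[OF F(2)])
  then show ?thesis
    unfolding smooth_line_def using F(1)
    by (intro exI[of _ "\<lambda>n x. c * p ^ n * F n (p * x + q)"]) auto
qed

section \<open>Flat bumps, smooth steps and plateau functions on the line\<close>

lemma power_le_fact_exp:
  fixes s :: real assumes "0 \<le> s" shows "s ^ n \<le> fact n * exp s"
proof -
  \<comment> \<open>A single term of the exponential series is at most the whole sum, all terms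
    being nonnegative for \<open>s \<ge> 0\<close>.\<close>
  have "(\<Sum>k\<in>{n}. s ^ k /\<^sub>R fact k) \<le> (\<Sum>k. s ^ k /\<^sub>R fact k)"
    by (rule sum_le_suminf) (use assms summable_exp_generic[of s] in auto)
  then have "s ^ n / fact n \<le> exp s" by (simp add: exp_def divide_inverse ac_simps)
  then show ?thesis by (simp add: field_simps)
qed

text \<open>Up to the choice of \<open>k\<close> and \<open>r\<close>, these functions are closed under differentiation, so each of
  them is smooth.\<close>

definition bump :: "nat \<Rightarrow> real poly \<Rightarrow> real \<Rightarrow> real"
  where "bump k r t = (if 0 < t \<and> t < 1
    then poly r t / (t * (1 - t)) ^ k * exp (- 1 / (t * (1 - t))) else 0)"

text \<open>With \<open>w = t * (1 - t)\<close>, the factor \<open>exp (- 1 / w)\<close> beats the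
  pole \<open>1 / w ^ k\<close> with room for two more powers of \<open>w\<close>, and
  \<open>poly r\<close> is bounded on the unit interval. Quadratic decay is what makes the
  derivative vanish at the endpoints 0 and 1.\<close>

lemma bump_quadratic_bound: "\<exists>C. \<forall>t. \<bar>bump k r t\<bar> \<le> C * (t * (1 - t))\<^sup>2"
proof -
  have "compact (poly r ` {0..1})" by (intro compact_continuous_image continuous_intros) auto
  then obtain B where B: "\<And>t. 0 \<le> t \<Longrightarrow> t \<le> 1 \<Longrightarrow> \<bar>poly r t\<bar> \<le> B"
    by (force dest!: compact_imp_bounded simp: bounded_iff)
  have "\<bar>bump k r t\<bar> \<le> B * fact (k + 2) * (t * (1 - t))\<^sup>2" for t
  proof (cases "0 < t \<and> t < 1")
    case True
    define w where "w = t * (1 - t)"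
    have w: "w > 0" using True by (simp add: w_def)
    have "B \<ge> 0" using B[of 0] by simp
    have "(1 / w) ^ (k + 2) \<le> fact (k + 2) * exp (1 / w)"
      by (rule power_le_fact_exp) (use w in auto)
    then have *: "exp (- 1 / w) / w ^ k \<le> fact (k + 2) * w\<^sup>2"
      using w by (simp add: exp_minus field_simps power_add power2_eq_square)
    have "\<bar>bump k r t\<bar> = \<bar>poly r t\<bar> * (exp (- 1 / w) / w ^ k)"
      using True w by (simp add: bump_def w_def[symmetric] abs_mult)
    also have "\<dots> \<le> B * (fact (k + 2) * w\<^sup>2)"
      using B[of t] True * w \<open>B \<ge> 0\<close> by (intro mult_mono) auto
    finally show ?thesis by (simp add: w_def ac_simps)
  next
    case False
    have "B \<ge> 0" using B[of 0] by simp
    then show ?thesis using False by (auto simp: bump_def)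
  qed
  then show ?thesis by blast
qed

lemma has_real_derivative_0_quadratic:
  fixes f :: "real \<Rightarrow> real"
  assumes "\<And>y. \<bar>y - x\<bar> \<le> 1 \<Longrightarrow> \<bar>f y\<bar> \<le> C * (y - x)\<^sup>2"
  shows "(f has_real_derivative 0) (at x)"
proof -
  have fx: "f x = 0" using assms[of x] by simp
  have "((\<lambda>y. C * \<bar>y - x\<bar>) \<longlongrightarrow> C * \<bar>x - x\<bar>) (at x)" by (intro tendsto_intros)
  then have lim: "((\<lambda>y. C * \<bar>y - x\<bar>) \<longlongrightarrow> 0) (at x)" by simp
  have "((\<lambda>y. (f y - f x) / (y - x)) \<longlongrightarrow> 0) (at x)"
  proof (rule Lim_null_comparison[OF _ lim])
    have "norm ((f y - f x) / (y - x)) \<le> C * \<bar>y - x\<bar>" if "y \<noteq> x" "\<bar>y - x\<bar> < 1" for y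
      using assms[of y] that fx by (simp add: field_simps power2_eq_square abs_mult)
    then show "\<forall>\<^sub>F y in at x. norm ((f y - f x) / (y - x)) \<le> C * \<bar>y - x\<bar>"
      unfolding eventually_at by (intro exI[of _ 1]) (auto simp: dist_real_def)
  qed
  then show ?thesis by (simp add: has_field_derivative_iff)
qed

text \<open>Here \<open>W\<close> is the polynomial \<open>t * (1 - t)\<close> and \<open>V\<close>
  its derivative. Inside the interval the quotient, product and chain rules give the new parameters
  over the common denominator \<open>W ^ (k + 2)\<close>; outside the closed interval the function
  is locally zero; at 0 and 1 the quadratic bound gives derivative 0.\<close>

lemma bump_deriv:
  defines "W \<equiv> [:0, 1, -1:]" and "V \<equiv> [:1, -2:]"
  shows "(bump k r has_real_derivative
    bump (k + 2) (pderiv r * W ^ 2 - of_nat k * r * W * V + r * V) t) (at t)"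
proof -
  consider "0 < t \<and> t < 1" | "t < 0 \<or> t > 1" | "t = 0 \<or> t = 1" by linarith
  then show ?thesis
  proof cases
    case 1
    define w where "w = t * (1 - t)"
    have w: "w > 0" using 1 by (simp add: w_def)
    have W: "poly W t = w" "poly V t = 1 - 2 * t"
      by (auto simp: W_def V_def w_def algebra_simps)
    have dw: "((\<lambda>t. t * (1 - t)) has_real_derivative (1 - 2 * t)) (at t)"
      by (auto intro!: derivative_eq_intros)
    have dpow: "((\<lambda>t. (t * (1 - t)) ^ k) has_real_derivative
        of_nat k * w ^ (k - 1) * (1 - 2 * t)) (at t)"
      using DERIV_power[OF dw, of k] by (simp add: w_def ac_simps)
    have dexp: "((\<lambda>t. exp (- 1 / (t * (1 - t)))) has_real_derivative
        exp (- 1 / w) * ((1 - 2 * t) / w\<^sup>2)) (at t)"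
    proof -
      have "((\<lambda>t. - 1 / (t * (1 - t))) has_real_derivative (1 - 2 * t) / w\<^sup>2) (at t)"
        using DERIV_divide[OF DERIV_const[of "-1"] dw] w
        by (simp add: w_def[symmetric] power2_eq_square)
      from DERIV_chain2[OF DERIV_exp this] show ?thesis by (simp add: w_def)
    qed
    \<comment> \<open>For \<open>k = 0\<close> the exponent \<open>k - 1\<close> is truncated to 0,
      which the vanishing factor \<open>of_nat k\<close> makes harmless.\<close>
    have k: "of_nat k * w ^ (k - 1) * w = of_nat k * w ^ k"
      by (cases k) auto
    have "((\<lambda>t. poly r t / (t * (1 - t)) ^ k * exp (- 1 / (t * (1 - t)))) has_real_derivative
        (poly (pderiv r) t * w ^ k - poly r t * (of_nat k * w ^ (k - 1) * (1 - 2 * t)))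
          / (w ^ k * w ^ k) * exp (- 1 / w)
        + poly r t / w ^ k * (exp (- 1 / w) * ((1 - 2 * t) / w\<^sup>2))) (at t)"
      by (rule DERIV_cong[OF DERIV_mult[OF DERIV_divide[OF poly_DERIV dpow] dexp]])
        (use w in \<open>simp_all add: w_def[symmetric] ac_simps\<close>)
    also have "(poly (pderiv r) t * w ^ k - poly r t * (of_nat k * w ^ (k - 1) * (1 - 2 * t)))
          / (w ^ k * w ^ k) * exp (- 1 / w)
        + poly r t / w ^ k * (exp (- 1 / w) * ((1 - 2 * t) / w\<^sup>2))
      = ((poly (pderiv r) t * w ^ k - poly r t * (of_nat k * w ^ (k - 1) * (1 - 2 * t))) * w * w
          + poly r t * w ^ k * (1 - 2 * t)) / (w ^ k * w ^ k * w\<^sup>2) * exp (- 1 / w)"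
      using w by (simp add: field_simps power2_eq_square)
    also have "(poly (pderiv r) t * w ^ k - poly r t * (of_nat k * w ^ (k - 1) * (1 - 2 * t))) * w * w
       = (poly (pderiv r) t * w ^ k * w - poly r t * ((of_nat k * w ^ (k - 1) * w) * (1 - 2 * t))) * w"
      by (simp add: algebra_simps)
    also have "\<dots> = w ^ k * (poly (pderiv r) t * w\<^sup>2 - of_nat k * poly r t * w * (1 - 2 * t))"
      unfolding k by (simp add: algebra_simps power2_eq_square)
    also have "(w ^ k * (poly (pderiv r) t * w\<^sup>2 - of_nat k * poly r t * w * (1 - 2 * t))
        + poly r t * w ^ k * (1 - 2 * t)) / (w ^ k * w ^ k * w\<^sup>2) * exp (- 1 / w)
      = (poly (pderiv r) t * w\<^sup>2 - of_nat k * poly r t * w * (1 - 2 * t) + poly r t * (1 - 2 * t))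
        / w ^ (k + 2) * exp (- 1 / w)" (is "(_ * ?X + _) / _ * _ = _")
    proof -
      have "w ^ k * ?X + poly r t * w ^ k * (1 - 2 * t) = w ^ k * (?X + poly r t * (1 - 2 * t))"
        by (simp add: distrib_left ac_simps)
      moreover have "w ^ k * w ^ k * w\<^sup>2 = w ^ k * w ^ (k + 2)"
        by (simp only: power_add mult.assoc)
      ultimately show ?thesis using w by (simp del: power_Suc add_2_eq_Suc')
    qed
    also have "\<dots> = bump (k + 2) (pderiv r * W ^ 2 - of_nat k * r * W * V + r * V) t"
      using 1 W by (simp add: bump_def w_def[symmetric])
    finally have d: "((\<lambda>t. poly r t / (t * (1 - t)) ^ k * exp (- 1 / (t * (1 - t))))
      has_real_derivative bump (k + 2) (pderiv r * W ^ 2 - of_nat k * r * W * V + r * V) t) (at t)" .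
    show ?thesis
      by (rule has_field_derivative_transform_within_open[OF d, of "{0<..<1}"])
        (use 1 in \<open>auto simp: bump_def\<close>)
  next
    case 2
    have d: "((\<lambda>t. 0) has_real_derivative
        bump (k + 2) (pderiv r * W ^ 2 - of_nat k * r * W * V + r * V) t) (at t)"
      using 2 by (auto simp: bump_def)
    show ?thesis
      by (rule has_field_derivative_transform_within_open[OF d, of "- {0..1}"])
        (use 2 in \<open>auto simp: bump_def open_Compl\<close>)
  next
    case 3
    obtain C where C: "\<And>t. \<bar>bump k r t\<bar> \<le> C * (t * (1 - t))\<^sup>2"
      using bump_quadratic_bound by blast
    have "C \<ge> 0" using order_trans[OF abs_ge_zero C[of "1/2"]] by (simp add: zero_le_mult_iff)
    \<comment> \<open>Near an endpoint \<open>t\<close>, one factor of \<open>y * (1 - y)\<close> is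
      \<open>y - t\<close> up to sign and the other is at most 2 in absolute value, as
      \<open>y\<close> is within distance 1 of \<open>t\<close>; squaring gives the 4.\<close>
    have "\<bar>bump k r y\<bar> \<le> C * 4 * (y - t)\<^sup>2" if y: "\<bar>y - t\<bar> \<le> 1" for y
    proof -
      have "\<bar>y * (1 - y)\<bar> \<le> \<bar>2 * (y - t)\<bar>"
      proof (cases "t = 0")
        case True
        then have "\<bar>y\<bar> * \<bar>1 - y\<bar> \<le> \<bar>y\<bar> * 2" using y by (intro mult_left_mono) auto
        then show ?thesis using True by (simp add: abs_mult)
      next
        case False
        then have "\<bar>y\<bar> * \<bar>1 - y\<bar> \<le> 2 * \<bar>1 - y\<bar>" using y 3 by (intro mult_right_mono) auto
        also have "\<dots> = \<bar>2 * (y - t)\<bar>" using False 3 by (auto simp: abs_if)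
        finally show ?thesis by (simp add: abs_mult)
      qed
      then have "(y * (1 - y))\<^sup>2 \<le> (2 * (y - t))\<^sup>2" by (simp only: abs_le_square_iff)
      then have "C * (y * (1 - y))\<^sup>2 \<le> C * (2 * (y - t))\<^sup>2" using \<open>C \<ge> 0\<close> by (rule mult_left_mono)
      moreover have "C * (2 * (y - t))\<^sup>2 = C * 4 * (y - t)\<^sup>2"
        by (simp only: power_mult_distrib) simp
      ultimately show ?thesis using C[of y] by linarith
    qed
    from has_real_derivative_0_quadratic[OF this]
    have "(bump k r has_real_derivative 0) (at t)" .
    moreover have "bump (k + 2) q t = 0" for q using 3 by (auto simp: bump_def)
    ultimately show ?thesis by (simp only:)
  qed
qed

lemma smooth_line_bump: "smooth_line (bump k r)"
proof -
  \<comment> \<open>\<open>?step\<close> sends the parameters of a bump to those of its derivative,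
    so \<open>?F n\<close> is the \<open>n\<close>-th derivative.\<close>
  let ?step = "\<lambda>(k, r). (k + 2, pderiv r * [:0, 1, -1:] ^ 2
    - of_nat k * r * [:0, 1, -1:] * [:1, -2:] + r * [:1, -2::real:])"
  let ?F = "\<lambda>n. (case (?step ^^ n) (k, r) of (k', r') \<Rightarrow> bump k' r')"
  have "(?F n has_real_derivative ?F (Suc n) x) (at x)" for n x
    using bump_deriv[of "fst ((?step ^^ n) (k, r))" "snd ((?step ^^ n) (k, r))" x]
    by (simp add: case_prod_unfold del: mult_pCons_left mult_pCons_right)
  then show ?thesis
    unfolding smooth_line_def by (intro exI[of _ ?F]) auto
qed

text \<open>\<open>S\<close> is a primitive of the nonnegative function \<open>bump 0 1\<close>,
  shifted to vanish at 0 and divided by the total mass, which is positive because the bump is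
  positive inside the interval.\<close>

lemma smooth_step_exists:
  obtains S S' :: "real \<Rightarrow> real" and C :: real
  where "smooth_line S" "\<And>t. (S has_real_derivative S' t) (at t)" "mono S"
    "\<And>t. t \<le> 0 \<Longrightarrow> S t = 0" "\<And>t. t \<ge> 1 \<Longrightarrow> S t = 1"
    "\<And>t. t \<le> 0 \<or> t \<ge> 1 \<Longrightarrow> S' t = 0" "\<And>t. \<bar>S' t\<bar> \<le> C"
proof -
  define \<rho> where "\<rho> = bump 0 1"
  have \<rho>0: "\<rho> t = 0" if "t \<le> 0 \<or> t \<ge> 1" for t using that by (auto simp: \<rho>_def bump_def)
  have \<rho>pos: "\<rho> t > 0" if "0 < t" "t < 1" for t using that by (auto simp: \<rho>_def bump_def)
  have \<rho>ge: "\<rho> t \<ge> 0" for t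
    using \<rho>0[of t] \<rho>pos[of t] by fastforce
  have \<rho>le: "\<bar>\<rho> t\<bar> \<le> 1" for t
    by (auto simp: \<rho>_def bump_def)
  have "isCont \<rho> t" for t unfolding \<rho>_def by (rule DERIV_isCont[OF bump_deriv])
  then obtain R where R: "(R has_real_derivative \<rho> t) (at t)" for t
    using einterval_antiderivative[of "-\<infinity>" "\<infinity>" \<rho>] by (auto simp: has_real_derivative_iff_has_vector_derivative)
  have contR: "continuous_on X R" for X
    using R by (intro continuous_at_imp_continuous_on ballI DERIV_isCont)
  have mono: "R s \<le> R t" if "s \<le> t" for s t
    by (rule DERIV_nonneg_imp_nondecreasing[OF that]) (use R \<rho>ge in blast)
  have const0: "R t = R 0" if "t \<le> 0" for t
  proof (cases "t = 0")
    case False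
    have "(R has_real_derivative 0) (at x)" if "x < 0" for x using R[of x] \<rho>0[of x] that by simp
    then show ?thesis
      using DERIV_isconst_end[of t 0 R] False that contR by auto
  qed simp
  have const1: "R t = R 1" if "t \<ge> 1" for t
  proof (cases "t = 1")
    case False
    have "(R has_real_derivative 0) (at x)" if "x > 1" for x using R[of x] \<rho>0[of x] that by simp
    then show ?thesis
      using DERIV_isconst_end[of 1 t R] False that contR by auto
  qed simp
  have "R 0 < R 1"
    by (rule DERIV_pos_imp_increasing_open)
      (use R \<rho>pos contR in auto)
  define m where "m = R 1 - R 0"
  have m: "m > 0" using \<open>R 0 < R 1\<close> by (simp add: m_def)
  let ?S = "\<lambda>t. (R t - R 0) / m"
  have dS: "(?S has_real_derivative \<rho> t / m) (at t)" for t
    using m by (auto intro!: derivative_eq_intros R)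
  show thesis
  proof (rule that)
    show "smooth_line ?S"
      using smooth_line_affine[of "bump 0 1" "1 / m" 1 0]
      by (intro smooth_lineI[OF _ dS]) (auto simp: \<rho>_def smooth_line_bump)
    show "mono ?S" using m mono by (intro monoI divide_right_mono diff_right_mono) auto
    show "?S t = 0" if "t \<le> 0" for t using const0[OF that] by simp
    show "?S t = 1" if "t \<ge> 1" for t using const1[OF that] m by (simp add: m_def)
    show "\<rho> t / m = 0" if "t \<le> 0 \<or> t \<ge> 1" for t using \<rho>0[OF that] by simp
    show "\<bar>\<rho> t / m\<bar> \<le> 1 / m" for t using \<rho>le[of t] m by (simp add: divide_right_mono)
    show "(?S has_real_derivative \<rho> t / m) (at t)" for t by (rule dS)
  qed
qed

text \<open>The difference of two rescaled copies of the smooth step works: the first rises between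
  \<open>a\<close> and \<open>2 * a\<close>, the second cancels it between \<open>1 - 2 * a\<close>
  and \<open>1 - a\<close>. Rescaling costs a factor \<open>1 / a\<close> in the derivative, with a
  constant that does not depend on \<open>a\<close>; \<open>a \<le> 1 / 4\<close> keeps the rise
  before the fall.\<close>

lemma plateau_exists:
  obtains C :: real where "C > 0" and
    "\<And>a::real. 0 < a \<Longrightarrow> a \<le> 1 / 4 \<Longrightarrow> \<exists>b b'. smooth_line b \<and>
      (\<forall>t. (b has_real_derivative b' t) (at t)) \<and> (\<forall>t. 0 \<le> b t \<and> b t \<le> 1) \<and>
      (\<forall>t. t \<le> a \<or> t \<ge> 1 - a \<longrightarrow> b t = 0) \<and> (\<forall>t. 2 * a \<le> t \<and> t \<le> 1 - 2 * a \<longrightarrow> b t = 1) \<and>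
      (\<forall>t. \<bar>b' t\<bar> \<le> C / a) \<and> (\<forall>t. 2 * a \<le> t \<and> t \<le> 1 - 2 * a \<longrightarrow> b' t = 0)"
proof -
  obtain S S' :: "real \<Rightarrow> real" and C :: real
    where S: "smooth_line S" "\<And>t. (S has_real_derivative S' t) (at t)" "mono S"
    "\<And>t. t \<le> 0 \<Longrightarrow> S t = 0" "\<And>t. t \<ge> 1 \<Longrightarrow> S t = 1"
    "\<And>t. t \<le> 0 \<or> t \<ge> 1 \<Longrightarrow> S' t = 0" "\<And>t. \<bar>S' t\<bar> \<le> C"
    by (rule smooth_step_exists) blast
  have S01: "0 \<le> S t \<and> S t \<le> 1" for t
    using monoD[OF S(3), of 0 t] monoD[OF S(3), of t 1] S(4)[of 0] S(5)[of 1] S(4)[of t] S(5)[of t]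
    by (cases "t \<le> 0"; cases "1 \<le> t") auto
  have "C \<ge> 0" using S(7)[of 0] by linarith
  show thesis
  proof (rule that[of "2 * C + 1"])
    \<comment> \<open>Two values of \<open>S'\<close> differ by at most \<open>2 * C\<close>; the
      added 1 makes the constant positive knowing only \<open>C \<ge> 0\<close>.\<close>
    show "2 * C + 1 > 0" using \<open>C \<ge> 0\<close> by simp
    fix a :: real assume a: "0 < a" "a \<le> 1 / 4"
    define b where "b t = S ((t - a) / a) - S ((t - 1 + 2 * a) / a)" for t
    define b' where "b' t = (S' ((t - a) / a) - S' ((t - 1 + 2 * a) / a)) / a" for t
    have "smooth_line b"
      using smooth_line_diff[OF smooth_line_affine[OF S(1), of 1 "1 / a" "-1"]
          smooth_line_affine[OF S(1), of 1 "1 / a" "(2 * a - 1) / a"]] a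
      by (simp add: b_def[abs_def] field_simps)
    moreover have "(b has_real_derivative b' t) (at t)" for t
      unfolding b_def b'_def using a
      by (auto intro!: derivative_eq_intros DERIV_chain2[OF S(2)] simp: field_simps)
    moreover have "0 \<le> b t \<and> b t \<le> 1" for t
    proof -
      have "S ((t - 1 + 2 * a) / a) \<le> S ((t - a) / a)"
        using a by (intro monoD[OF S(3)] divide_right_mono) auto
      then show ?thesis using S01[of "(t - a) / a"] S01[of "(t - 1 + 2 * a) / a"] by (simp add: b_def)
    qed
    moreover have "b t = 0" if "t \<le> a \<or> t \<ge> 1 - a" for t
    proof (cases "t \<le> a")
      case True
      then show ?thesis
        using S(4)[of "(t - a) / a"] S(4)[of "(t - 1 + 2 * a) / a"] a
        by (simp add: b_def divide_nonpos_pos)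
    next
      case False
      then show ?thesis
        using S(5)[of "(t - a) / a"] S(5)[of "(t - 1 + 2 * a) / a"] a that
        by (simp add: b_def field_simps)
    qed
    moreover have "b t = 1 \<and> b' t = 0" if "2 * a \<le> t \<and> t \<le> 1 - 2 * a" for t
      using S(5)[of "(t - a) / a"] S(4)[of "(t - 1 + 2 * a) / a"]
        S(6)[of "(t - a) / a"] S(6)[of "(t - 1 + 2 * a) / a"] a that
      by (simp add: b_def b'_def field_simps)
    moreover have "\<bar>b' t\<bar> \<le> (2 * C + 1) / a" for t
    proof -
      have "\<bar>S' ((t - a) / a) - S' ((t - 1 + 2 * a) / a)\<bar> \<le> 2 * C + 1"
        using S(7)[of "(t - a) / a"] S(7)[of "(t - 1 + 2 * a) / a"] by linarith
      then show ?thesis using a by (simp add: b'_def divide_right_mono)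
    qed
    ultimately show "\<exists>b b'. smooth_line b \<and>
      (\<forall>t. (b has_real_derivative b' t) (at t)) \<and> (\<forall>t. 0 \<le> b t \<and> b t \<le> 1) \<and>
      (\<forall>t. t \<le> a \<or> t \<ge> 1 - a \<longrightarrow> b t = 0) \<and> (\<forall>t. 2 * a \<le> t \<and> t \<le> 1 - 2 * a \<longrightarrow> b t = 1) \<and>
      (\<forall>t. \<bar>b' t\<bar> \<le> (2 * C + 1) / a) \<and> (\<forall>t. 2 * a \<le> t \<and> t \<le> 1 - 2 * a \<longrightarrow> b' t = 0)"
      by blast
  qed
qed

section \<open>Cutoff functions on the cube as products over the coordinates\<close>

lemma has_derivative_prod_coord:
  fixes x :: "real ^ 'n::finite"
  assumes "\<And>i. (b i has_real_derivative b' i) (at (x $ i))"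
  shows "((\<lambda>x. \<Prod>i\<in>UNIV. b i (x $ i)) has_derivative
    (\<lambda>h. \<Sum>i\<in>UNIV. b' i * h $ i * (\<Prod>j\<in>UNIV - {i}. b j (x $ j)))) (at x)"
proof -
  have "((\<lambda>x. b i (x $ i)) has_derivative (\<lambda>h. b' i * h $ i)) (at x)" for i
    using has_derivative_compose[OF bounded_linear_imp_has_derivative[OF bounded_linear_vec_nth]
        assms[of i, unfolded has_field_derivative_def]] .
  then show ?thesis by (rule has_derivative_prod)
qed

lemma partial_prod_coord:
  fixes x :: "real ^ 'n::finite"
  assumes "\<And>i. (b i has_real_derivative b' i) (at (x $ i))"
  shows "partial j (\<lambda>x. \<Prod>i\<in>UNIV. b i (x $ i)) x = b' j * (\<Prod>i\<in>UNIV - {j}. b i (x $ i))"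
proof -
  have "partial j (\<lambda>x. \<Prod>i\<in>UNIV. b i (x $ i)) x
      = (\<Sum>i\<in>UNIV. b' i * axis j 1 $ i * (\<Prod>k\<in>UNIV - {i}. b k (x $ k)))"
    unfolding partial_def
    by (simp flip: frechet_derivative_at[OF has_derivative_prod_coord[of b b' x, OF assms]])
  also have "\<dots> = (\<Sum>i\<in>{j}. b' i * axis j 1 $ i * (\<Prod>k\<in>UNIV - {i}. b k (x $ k)))"
    by (rule sum.mono_neutral_right) (auto simp: axis_def)
  finally show ?thesis by simp
qed

text \<open>Products of smooth functions of single coordinates are closed under partial derivatives:
  differentiating in direction \<open>j\<close> replaces the factor of coordinate \<open>j\<close>
  by its derivative. Induction over the list of directions keeps every iterated partial derivative
  in this class, whose members are differentiable.\<close>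

lemma smooth_prod_coord:
  fixes b :: "'n::finite \<Rightarrow> real \<Rightarrow> real"
  assumes "\<And>i. smooth_line (b i)"
  shows "smooth (\<lambda>x::real^'n. \<Prod>i\<in>UNIV. b i (x $ i))"
proof -
  have "\<exists>c. (\<forall>i. smooth_line (c i)) \<and>
      foldr partial js (\<lambda>x::real^'n. \<Prod>i\<in>UNIV. b i (x $ i)) = (\<lambda>x. \<Prod>i\<in>UNIV. c i (x $ i))" for js
  proof (induction js)
    case Nil
    then show ?case using assms by auto
  next
    case (Cons j js)
    then obtain c where c: "\<And>i. smooth_line (c i)"
      "foldr partial js (\<lambda>x::real^'n. \<Prod>i\<in>UNIV. b i (x $ i)) = (\<lambda>x. \<Prod>i\<in>UNIV. c i (x $ i))"
      by blast
    have "\<forall>i. \<exists>d. smooth_line d \<and> (\<forall>x. (c i has_real_derivative d x) (at x))"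
      using smooth_line_deriv[OF c(1)] by blast
    then obtain d where d: "\<And>i. smooth_line (d i)" "\<And>i x. (c i has_real_derivative d i x) (at x)"
      by metis
    have "(\<Prod>i\<in>UNIV. (c(j := d j)) i (x $ i)) = d j (x $ j) * (\<Prod>i\<in>UNIV - {j}. c i (x $ i))"
      for x :: "real ^ 'n"
    proof -
      have "(\<Prod>i\<in>UNIV. (c(j := d j)) i (x $ i))
          = d j (x $ j) * (\<Prod>i\<in>UNIV - {j}. (c(j := d j)) i (x $ i))"
        by (subst prod.remove[of _ j]) auto
      also have "(\<Prod>i\<in>UNIV - {j}. (c(j := d j)) i (x $ i)) = (\<Prod>i\<in>UNIV - {j}. c i (x $ i))"
        by (rule prod.cong) auto
      finally show ?thesis .
    qed
    then have "partial j (\<lambda>x::real^'n. \<Prod>i\<in>UNIV. c i (x $ i))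
        = (\<lambda>x. \<Prod>i\<in>UNIV. (c(j := d j)) i (x $ i))"
      using partial_prod_coord[of c "\<lambda>i. d i (x $ i)" x j for x, OF d(2)] by (simp add: fun_eq_iff)
    then show ?case
      using c d(1) by (intro exI[of _ "c(j := d j)"]) auto
  qed
  moreover have "(\<lambda>x::real^'n. \<Prod>i\<in>UNIV. c i (x $ i)) differentiable at x"
    if c: "\<And>i. smooth_line (c i)" for c x
  proof -
    have "\<forall>i. \<exists>d. (c i has_real_derivative d) (at (x $ i))"
      using smooth_line_deriv[OF c] by metis
    then obtain d where "\<And>i. (c i has_real_derivative d i) (at (x $ i))" by metis
    then show ?thesis using has_derivative_prod_coord[of c d x] by (auto simp: differentiable_def)
  qed
  ultimately show ?thesis unfolding smooth_def by metis
qed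

text \<open>The same plateau function is used in every coordinate. In \<open>partial j\<close> only
  the factor of coordinate \<open>j\<close> is differentiated while the others stay between 0 and 1,
  so this derivative is at most \<open>C / a\<close> and lives only in slabs along the two faces
  orthogonal to direction \<open>j\<close>. The constant \<open>C\<close> is chosen before
  \<open>a\<close>.\<close>

lemma unit_cube_cutoff:
  obtains C :: real where "C > 0" and
    "\<And>a. 0 < a \<Longrightarrow> a \<le> 1 / 4 \<Longrightarrow> \<exists>\<psi>\<in>test_functions (unit_cube :: (real ^ 'n::finite) set).
      (\<forall>x. 0 \<le> \<psi> x \<and> \<psi> x \<le> 1) \<and>
      (\<forall>x. (\<forall>i. 2 * a \<le> x $ i \<and> x $ i \<le> 1 - 2 * a) \<longrightarrow> \<psi> x = 1) \<and>
      (\<forall>j x. \<bar>partial j \<psi> x\<bar> \<le> C / a) \<and>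
      (\<forall>j x. 2 * a \<le> x $ j \<and> x $ j \<le> 1 - 2 * a \<longrightarrow> partial j \<psi> x = 0)"
proof -
  obtain C :: real where "C > 0" and C:
    "\<And>a::real. 0 < a \<Longrightarrow> a \<le> 1 / 4 \<Longrightarrow> \<exists>b b'. smooth_line b \<and>
      (\<forall>t. (b has_real_derivative b' t) (at t)) \<and> (\<forall>t. 0 \<le> b t \<and> b t \<le> 1) \<and>
      (\<forall>t. t \<le> a \<or> t \<ge> 1 - a \<longrightarrow> b t = 0) \<and> (\<forall>t. 2 * a \<le> t \<and> t \<le> 1 - 2 * a \<longrightarrow> b t = 1) \<and>
      (\<forall>t. \<bar>b' t\<bar> \<le> C / a) \<and> (\<forall>t. 2 * a \<le> t \<and> t \<le> 1 - 2 * a \<longrightarrow> b' t = 0)"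
    by (rule plateau_exists) blast
  show thesis
  proof (rule that[OF \<open>C > 0\<close>])
    fix a :: real assume a: "0 < a" "a \<le> 1 / 4"
    obtain b b' where b: "smooth_line b" "\<And>t. (b has_real_derivative b' t) (at t)"
      "\<And>t. 0 \<le> b t" "\<And>t. b t \<le> 1" "\<And>t. t \<le> a \<or> t \<ge> 1 - a \<Longrightarrow> b t = 0"
      "\<And>t. 2 * a \<le> t \<Longrightarrow> t \<le> 1 - 2 * a \<Longrightarrow> b t = 1"
      "\<And>t. \<bar>b' t\<bar> \<le> C / a" "\<And>t. 2 * a \<le> t \<Longrightarrow> t \<le> 1 - 2 * a \<Longrightarrow> b' t = 0"
      using C[OF a] by blast
    define \<psi> where "\<psi> x = (\<Prod>i\<in>UNIV. b (x $ i))" for x :: "real ^ 'n"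
    have partial: "partial j \<psi> x = b' (x $ j) * (\<Prod>i\<in>UNIV - {j}. b (x $ i))" for j x
      using partial_prod_coord[of "\<lambda>_. b" "\<lambda>i. b' (x $ i)" x j, OF b(2)] by (simp add: \<psi>_def[abs_def])
    have "closure {x. \<psi> x \<noteq> 0} \<subseteq> cbox (\<chi> i. a) (\<chi> i. 1 - a)"
    proof (rule closure_minimal)
      show "{x. \<psi> x \<noteq> 0} \<subseteq> cbox (\<chi> i. a) (\<chi> i. 1 - a)"
      proof
        fix x assume "x \<in> {x. \<psi> x \<noteq> 0}"
        then have "b (x $ i) \<noteq> 0" for i by (simp add: \<psi>_def)
        then have "a \<le> x $ i \<and> x $ i \<le> 1 - a" for i using b(5)[of "x $ i"] by fastforce
        then show "x \<in> cbox (\<chi> i. a) (\<chi> i. 1 - a)" by (simp add: mem_box_cart)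
      qed
    qed (rule closed_cbox)
    moreover have "cbox (\<chi> i. a) (\<chi> i. 1 - a) \<subseteq> (unit_cube :: (real ^ 'n) set)"
    proof
      fix x :: "real ^ 'n" assume "x \<in> cbox (\<chi> i. a) (\<chi> i. 1 - a)"
      then have "0 < x $ i \<and> x $ i < 1" for i
        using a by (auto simp: mem_box_cart dest: spec[of _ i])
      then show "x \<in> unit_cube" by (simp add: mem_box_cart)
    qed
    moreover have "smooth \<psi>"
      using smooth_prod_coord[of "\<lambda>_. b", OF b(1)] by (simp add: \<psi>_def[abs_def])
    ultimately have "\<psi> \<in> test_functions unit_cube"
      unfolding test_functions_def
      by (auto intro: compact_cbox closed_closure bounded_cbox bounded_subset simp: compact_eq_bounded_closed)
    moreover have "0 \<le> \<psi> x \<and> \<psi> x \<le> 1" for x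
      using b(3,4) by (simp add: \<psi>_def prod_nonneg prod_le_1)
    moreover have "\<psi> x = 1" if "\<forall>i. 2 * a \<le> x $ i \<and> x $ i \<le> 1 - 2 * a" for x
      using b(6) that by (simp add: \<psi>_def)
    moreover have "\<bar>partial j \<psi> x\<bar> \<le> C / a" for j x
    proof -
      have "\<bar>partial j \<psi> x\<bar> \<le> \<bar>b' (x $ j)\<bar> * 1"
        unfolding partial abs_mult using b(3,4)
        by (intro mult_left_mono) (simp_all add: prod_nonneg prod_le_1)
      then show ?thesis using b(7)[of "x $ j"] by simp
    qed
    moreover have "partial j \<psi> x = 0" if "2 * a \<le> x $ j \<and> x $ j \<le> 1 - 2 * a" for j x
      using b(8) that by (simp add: partial)
    ultimately show "\<exists>\<psi>\<in>test_functions (unit_cube :: (real ^ 'n) set).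
      (\<forall>x. 0 \<le> \<psi> x \<and> \<psi> x \<le> 1) \<and>
      (\<forall>x. (\<forall>i. 2 * a \<le> x $ i \<and> x $ i \<le> 1 - 2 * a) \<longrightarrow> \<psi> x = 1) \<and>
      (\<forall>j x. \<bar>partial j \<psi> x\<bar> \<le> C / a) \<and>
      (\<forall>j x. 2 * a \<le> x $ j \<and> x $ j \<le> 1 - 2 * a \<longrightarrow> partial j \<psi> x = 0)"
      by blast
  qed
qed

subsection \<open>The mean of a weak gradient\<close>

lemma emeasure_unit_cube: "emeasure lebesgue (unit_cube :: (real ^ 'n::finite) set) = 1"
proof -
  have "(1 :: real ^ 'n) \<bullet> b = 1" if "b \<in> Basis" for b
    using that by (auto simp: Basis_vec_def inner_axis)
  then show ?thesis by (simp add: emeasure_lborel_box_eq)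
qed

lemma prob_space_unit_cube: "prob_space (lebesgue_on (unit_cube :: (real ^ 'n::finite) set))"
  by (rule prob_spaceI) (simp add: emeasure_restrict_space emeasure_unit_cube)

lemma Linf_AE_bounded:
  assumes "u \<in> Linf \<Omega>"
  obtains B where "AE x in lebesgue_on \<Omega>. norm (u x) \<le> B"
proof -
  have s: "Linf_norm \<Omega> u < \<infinity>" using assms by (simp add: Linf_def)
  then obtain B where B: "Linf_norm \<Omega> u \<le> ereal B" by (cases "Linf_norm \<Omega> u") auto
  have "AE x in lebesgue_on \<Omega>. ereal (norm (u x)) \<le> Linf_norm \<Omega> u"
    unfolding Linf_norm_def by (rule esssup_AE)
  then have "AE x in lebesgue_on \<Omega>. norm (u x) \<le> B"
    by eventually_elim (use B in \<open>metis ereal_less_eq(3) order_trans\<close>)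
  then show thesis by (rule that)
qed

text \<open>Within the cube, \<open>h\<close> lives on two slabs \<open>A\<close> and
  \<open>B\<close> along the faces orthogonal to direction \<open>j\<close>, each of volume
  \<open>2 * a\<close>.\<close>

lemma abs_integral_near_faces_le:
  fixes h :: "real ^ 'n::finite \<Rightarrow> real" and j :: 'n
  assumes a: "0 < a" "a \<le> 1 / 4" and D: "D \<ge> 0"
    and bound: "\<And>x. x \<in> unit_cube \<Longrightarrow> \<bar>h x\<bar> \<le> D"
    and zero: "\<And>x. x \<in> unit_cube \<Longrightarrow> 2 * a \<le> x $ j \<Longrightarrow> x $ j \<le> 1 - 2 * a \<Longrightarrow> h x = 0"
  shows "\<bar>LINT x|lebesgue_on unit_cube. h x\<bar> \<le> 4 * a * D"
proof -
  let ?Q = "unit_cube :: (real ^ 'n) set"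
  let ?M = "lebesgue_on ?Q"
  interpret prob_space ?M by (rule prob_space_unit_cube)
  define A :: "(real ^ 'n) set" where "A = cbox 0 (\<chi> k. if k = j then 2 * a else 1)"
  define B :: "(real ^ 'n) set" where "B = cbox (\<chi> k. if k = j then 1 - 2 * a else 0) 1"
  have "measure lebesgue A = (\<Prod>k\<in>UNIV. if k = j then 2 * a else 1)"
    unfolding A_def using a by (subst measure_completion, simp, subst content_cbox_cart)
      (auto simp: interval_ne_empty_cart intro!: prod.cong)
  then have mA: "measure lebesgue A = 2 * a" by simp
  have "1 - (if k = j then 1 - 2 * a else 0) = (if k = j then 2 * a else 1)" for k by simp
  then have "measure lebesgue B = (\<Prod>k\<in>UNIV. if k = j then 2 * a else 1)"
    unfolding B_def using a by (subst measure_completion, simp, subst content_cbox_cart)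
      (auto simp: interval_ne_empty_cart intro!: prod.cong)
  then have mB: "measure lebesgue B = 2 * a" by simp
  have fm: "X \<inter> ?Q \<in> sets ?M" "measure ?M (X \<inter> ?Q) \<le> measure lebesgue X"
    if "X = A \<or> X = B" for X
  proof -
    have X: "X \<in> lmeasurable" using that by (auto simp: A_def B_def)
    then show "X \<inter> ?Q \<in> sets ?M" by (auto simp: sets_restrict_space fmeasurable_def)
    have "measure ?M (X \<inter> ?Q) = measure lebesgue (X \<inter> ?Q)"
      by (rule measure_restrict_space) auto
    also have "\<dots> \<le> measure lebesgue X"
      using X by (intro measure_mono_fmeasurable) auto
    finally show "measure ?M (X \<inter> ?Q) \<le> measure lebesgue X" .
  qed
  have [measurable]: "A \<inter> ?Q \<in> sets ?M" "B \<inter> ?Q \<in> sets ?M" using fm(1) by auto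
  let ?g = "\<lambda>x. D * indicator (A \<inter> ?Q) x + D * indicator (B \<inter> ?Q) x :: real"
  have int: "integrable ?M (\<lambda>x. D * indicator (A \<inter> ?Q) x)" "integrable ?M (\<lambda>x. D * indicator (B \<inter> ?Q) x)"
    by (auto intro!: integrable_mult_right integrable_real_indicator simp: less_top[symmetric])
  have "\<bar>LINT x|?M. h x\<bar> \<le> (LINT x|?M. \<bar>h x\<bar>)" by (rule integral_abs_bound)
  \<comment> \<open>The rule \<open>integral_mono'\<close> asks for integrability of the majorant
    alone: an integrand that is not integrable has integral 0, and the majorant is
    nonnegative.\<close>
  also have "\<dots> \<le> (LINT x|?M. ?g x)"
  proof (rule integral_mono')
    fix x assume "x \<in> space ?M"
    then have x: "x \<in> ?Q" by simp
    show "\<bar>h x\<bar> \<le> ?g x"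
    proof (cases "2 * a \<le> x $ j \<and> x $ j \<le> 1 - 2 * a")
      case True
      then show ?thesis using zero[OF x] D by (simp add: indicator_def)
    next
      case False
      then have "x \<in> A \<or> x \<in> B"
        using x by (auto simp: A_def B_def mem_box_cart less_imp_le not_le)
      then show ?thesis using bound[OF x] D x by (auto simp: indicator_def)
    qed
  qed (use int D in auto)
  also have "\<dots> = D * measure ?M (A \<inter> ?Q) + D * measure ?M (B \<inter> ?Q)"
    using int by (simp add: Int_absorb2 sets.sets_into_space)
  also have "\<dots> \<le> D * (2 * a) + D * (2 * a)"
    using fm(2)[of A] fm(2)[of B] D mA mB by (intro add_mono mult_left_mono) auto
  finally show ?thesis by (simp add: algebra_simps)
qed

text \<open>By uniform continuity on the compact closed cube: moving coordinate \<open>j\<close> of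
  \<open>x\<close> to the nearby face value gives a boundary point \<open>y\<close> with
  \<open>norm (\<phi> y) \<le> \<delta>\<close>, and \<open>\<phi>\<close> differs by less than
  \<open>\<delta>\<close> between the two points.\<close>

lemma small_near_frontier_unit_cube:
  fixes \<phi> :: "real ^ 'n::finite \<Rightarrow> 'b::real_normed_vector"
  assumes cont: "continuous_on (closure unit_cube) \<phi>" and "\<delta> > 0"
    and bd: "\<And>x. x \<in> frontier unit_cube \<Longrightarrow> norm (\<phi> x) \<le> \<delta>"
  obtains \<eta> where "\<eta> > 0"
    "\<And>x j. x \<in> unit_cube \<Longrightarrow> x $ j < \<eta> \<or> 1 - \<eta> < x $ j \<Longrightarrow> norm (\<phi> x) \<le> 2 * \<delta>"
proof -
  let ?Q = "unit_cube :: (real ^ 'n) set"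
  have cl: "closure ?Q = cbox 0 1"
    by (rule closure_box) (auto simp: interval_ne_empty_cart)
  have fr: "frontier ?Q = cbox 0 1 - ?Q"
    unfolding frontier_def cl by (simp only: interior_open[OF open_box])
  have "uniformly_continuous_on (cbox 0 1) \<phi>"
    using cont cl by (auto intro: compact_uniformly_continuous compact_cbox)
  then obtain \<eta> where "\<eta> > 0" and \<eta>:
    "\<And>x y. x \<in> cbox 0 1 \<Longrightarrow> y \<in> cbox 0 1 \<Longrightarrow> dist y x < \<eta> \<Longrightarrow> dist (\<phi> y) (\<phi> x) < \<delta>"
    using \<open>\<delta> > 0\<close> unfolding uniformly_continuous_on_def by metis
  show thesis
  proof (rule that[OF \<open>\<eta> > 0\<close>])
    fix x :: "real ^ 'n" and j assume x: "x \<in> ?Q" and xj: "x $ j < \<eta> \<or> 1 - \<eta> < x $ j"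
    have "0 < x $ j" "x $ j < 1" using x by (auto simp: mem_box_cart)
    then obtain c :: real where c: "c = 0 \<or> c = 1" "\<bar>x $ j - c\<bar> < \<eta>"
      using that[of 0] that[of 1] xj by (cases "x $ j < \<eta>") (force simp: abs_if)+
    define y where "y = x + (c - x $ j) *\<^sub>R axis j 1"
    have y: "y $ i = (if i = j then c else x $ i)" for i by (simp add: y_def axis_def)
    have "y \<in> cbox 0 1 - ?Q"
      using c(1) x y by (auto simp: mem_box_cart less_imp_le intro!: exI[of _ j])
    then have "norm (\<phi> y) \<le> \<delta>" using bd fr by blast
    moreover have "dist (\<phi> x) (\<phi> y) < \<delta>"
    proof (rule \<eta>)
      show "dist x y < \<eta>" using c(2) by (simp add: y_def dist_norm abs_minus_commute)
      show "x \<in> cbox 0 1" using x box_subset_cbox by blast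
    qed (use \<open>y \<in> cbox 0 1 - ?Q\<close> in auto)
    ultimately show "norm (\<phi> x) \<le> 2 * \<delta>"
      using norm_triangle_ineq2[of "\<phi> x" "\<phi> y"] by (simp add: dist_norm)
  qed
qed

text \<open>In the weak gradient identity for a cutoff of width \<open>a\<close>, the derivative of
  size \<open>C / a\<close> acts only on slabs of total volume at most \<open>4 * a\<close>, where
  \<open>\<phi>\<close> is at most \<open>2 * \<delta>\<close>. The powers of \<open>a\<close>
  cancel, leaving \<open>8 * C * \<delta>\<close>, and \<open>a\<close> can tend to 0. The constant
  is uniform in \<open>\<phi>\<close> and \<open>G\<close>.\<close>

lemma integral_weak_gradient_le:
  obtains C :: real where "C > 0"
    "\<And>(\<phi> :: real ^ 'n::finite \<Rightarrow> real ^ 'd::finite) G \<delta> i j.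
      W1inf unit_cube \<phi> G \<Longrightarrow> continuous_on (closure unit_cube) \<phi> \<Longrightarrow> \<delta> > 0 \<Longrightarrow>
      \<forall>x\<in>frontier unit_cube. norm (\<phi> x) \<le> \<delta> \<Longrightarrow>
      \<bar>LINT x|lebesgue_on unit_cube. G x $ i $ j\<bar> \<le> C * \<delta>"
proof -
  let ?Q = "unit_cube :: (real ^ 'n) set"
  let ?M = "lebesgue_on ?Q"
  interpret prob_space ?M by (rule prob_space_unit_cube)
  obtain C :: real where "C > 0" and C:
    "\<And>a. 0 < a \<Longrightarrow> a \<le> 1 / 4 \<Longrightarrow> \<exists>\<psi>\<in>test_functions ?Q.
      (\<forall>x. 0 \<le> \<psi> x \<and> \<psi> x \<le> 1) \<and>
      (\<forall>x. (\<forall>i. 2 * a \<le> x $ i \<and> x $ i \<le> 1 - 2 * a) \<longrightarrow> \<psi> x = 1) \<and>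
      (\<forall>j x. \<bar>partial j \<psi> x\<bar> \<le> C / a) \<and>
      (\<forall>j x. 2 * a \<le> x $ j \<and> x $ j \<le> 1 - 2 * a \<longrightarrow> partial j \<psi> x = 0)"
    by (rule unit_cube_cutoff) blast
  show thesis
  proof (rule that[of "8 * C"])
    show "8 * C > 0" using \<open>C > 0\<close> by simp
    fix \<phi> :: "real ^ 'n \<Rightarrow> real ^ 'd" and G \<delta> i j
    assume W: "W1inf ?Q \<phi> G" and cont: "continuous_on (closure ?Q) \<phi>" and \<delta>: "\<delta> > 0"
      and bd: "\<forall>x\<in>frontier ?Q. norm (\<phi> x) \<le> \<delta>"
    obtain \<eta> where "\<eta> > 0" and \<eta>:
      "\<And>x j. x \<in> ?Q \<Longrightarrow> x $ j < \<eta> \<or> 1 - \<eta> < x $ j \<Longrightarrow> norm (\<phi> x) \<le> 2 * \<delta>"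
      using small_near_frontier_unit_cube[OF cont \<delta>] bd by blast
    \<comment> \<open>The widths start at 1/4, the largest that the cutoffs admit, and tend to
      0.\<close>
    define a where "a n = 1 / (real n + 4)" for n
    have a: "0 < a n" "a n \<le> 1 / 4" for n by (auto simp: a_def field_simps)
    have alim: "a \<longlonglongrightarrow> 0" unfolding a_def by real_asymp
    have "\<forall>n. \<exists>\<psi>\<in>test_functions ?Q.
      (\<forall>x. 0 \<le> \<psi> x \<and> \<psi> x \<le> 1) \<and>
      (\<forall>x. (\<forall>i. 2 * a n \<le> x $ i \<and> x $ i \<le> 1 - 2 * a n) \<longrightarrow> \<psi> x = 1) \<and>
      (\<forall>j x. \<bar>partial j \<psi> x\<bar> \<le> C / a n) \<and>
      (\<forall>j x. 2 * a n \<le> x $ j \<and> x $ j \<le> 1 - 2 * a n \<longrightarrow> partial j \<psi> x = 0)"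
      using C[OF a] by blast
    then obtain \<psi> where \<psi>: "\<And>n. \<psi> n \<in> test_functions ?Q" "\<And>n x. 0 \<le> \<psi> n x" "\<And>n x. \<psi> n x \<le> 1"
      "\<And>n x. (\<And>i. 2 * a n \<le> x $ i \<and> x $ i \<le> 1 - 2 * a n) \<Longrightarrow> \<psi> n x = 1"
      "\<And>n j x. \<bar>partial j (\<psi> n) x\<bar> \<le> C / a n"
      "\<And>n j x. 2 * a n \<le> x $ j \<Longrightarrow> x $ j \<le> 1 - 2 * a n \<Longrightarrow> partial j (\<psi> n) x = 0"
      by metis
    \<comment> \<open>Once \<open>2 * a n < \<eta>\<close>, the slabs carrying the derivative lie in
      the boundary layer where \<open>\<phi>\<close> is small.\<close>
    have small: "\<bar>LINT x|?M. G x $ i $ j * \<psi> n x\<bar> \<le> 8 * C * \<delta>" if n: "2 * a n < \<eta>" for n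
    proof -
      have "(LINT x|?M. \<phi> x $ i * partial j (\<psi> n) x) = - (LINT x|?M. G x $ i $ j * \<psi> n x)"
        using W \<psi>(1) by (auto simp: W1inf_def)
      moreover have "\<bar>LINT x|?M. \<phi> x $ i * partial j (\<psi> n) x\<bar> \<le> 4 * a n * (2 * \<delta> * (C / a n))"
      proof (rule abs_integral_near_faces_le[where j = j, OF a])
        show "0 \<le> 2 * \<delta> * (C / a n)" using \<delta> \<open>C > 0\<close> a(1)[of n] by simp
        show zero: "\<phi> x $ i * partial j (\<psi> n) x = 0" if "2 * a n \<le> x $ j" "x $ j \<le> 1 - 2 * a n" for x
          using \<psi>(6) that by simp
        fix x assume x: "x \<in> ?Q"
        show "\<bar>\<phi> x $ i * partial j (\<psi> n) x\<bar> \<le> 2 * \<delta> * (C / a n)"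
        proof (cases "2 * a n \<le> x $ j \<and> x $ j \<le> 1 - 2 * a n")
          case True
          then have "\<phi> x $ i * partial j (\<psi> n) x = 0" by (intro zero) auto
          then show ?thesis using \<open>0 \<le> 2 * \<delta> * (C / a n)\<close> by (simp only: abs_zero)
        next
          case False
          then have "norm (\<phi> x) \<le> 2 * \<delta>" using n by (intro \<eta>[OF x, of j]) auto
          then have "\<bar>\<phi> x $ i\<bar> \<le> 2 * \<delta>" using component_le_norm_cart[of "\<phi> x" i] by linarith
          then show ?thesis unfolding abs_mult using \<psi>(5)[of j n x] \<delta> by (intro mult_mono) auto
        qed
      qed
      moreover have "4 * a n * (2 * \<delta> * (C / a n)) = 8 * C * \<delta>" using a(1)[of n] by simp
      ultimately show ?thesis by simp
    qed
    have G: "G \<in> borel_measurable ?M" "G \<in> Linf ?Q" using W by (auto simp: W1inf_def Linf_def)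
    have Gij: "(\<lambda>x. G x $ i $ j) \<in> borel_measurable ?M"
      by (rule measurable_compose[OF G(1)]) (intro borel_measurable_continuous_onI continuous_intros)
    obtain B where B: "AE x in ?M. norm (G x) \<le> B" using Linf_AE_bounded[OF G(2)] .
    \<comment> \<open>Every point of the open cube eventually lies on the plateau, so the cutoffs
      tend to 1 pointwise; an almost everywhere bound on \<open>G\<close> dominates.\<close>
    have lim: "(\<lambda>n. LINT x|?M. G x $ i $ j * \<psi> n x) \<longlonglongrightarrow> (LINT x|?M. G x $ i $ j)"
    proof (rule integral_dominated_convergence[where w = "\<lambda>_. B"])
      show "(\<lambda>x. G x $ i $ j * \<psi> n x) \<in> borel_measurable ?M" for n
      proof -
        have "smooth (\<psi> n)" using \<psi>(1)[of n] by (simp add: test_functions_def)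
        then have "continuous_on ?Q (\<psi> n)"
          unfolding smooth_def
          by (intro continuous_at_imp_continuous_on ballI differentiable_imp_continuous_within)
            (metis foldr.simps(1) id_apply)
        then have "\<psi> n \<in> borel_measurable ?M" by (rule continuous_imp_measurable_on_sets_lebesgue) auto
        then show ?thesis using Gij by measurable
      qed
      show "AE x in ?M. norm (G x $ i $ j * \<psi> n x) \<le> B" for n
        using B
      proof eventually_elim
        case (elim x)
        have "\<bar>G x $ i $ j\<bar> * \<psi> n x \<le> \<bar>G x $ i $ j\<bar> * 1" using \<psi>(3) by (intro mult_left_mono) auto
        also have "\<dots> \<le> norm (G x)"
          using component_le_norm_cart[of "G x $ i" j] Finite_Cartesian_Product.norm_nth_le[of "G x" i] by simp
        finally show ?case using elim \<psi>(2)[of n x] by (simp add: abs_mult)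
      qed
      show "AE x in ?M. (\<lambda>n. G x $ i $ j * \<psi> n x) \<longlonglongrightarrow> G x $ i $ j"
      proof (rule AE_I2)
        fix x assume "x \<in> space ?M"
        then have x: "0 < x $ k \<and> x $ k < 1" for k by (simp add: mem_box_cart)
        have lim2: "(\<lambda>n. 2 * a n) \<longlonglongrightarrow> 0" using tendsto_mult_left[OF alim, of 2] by simp
        have "\<forall>\<^sub>F n in sequentially. \<forall>k. 2 * a n < x $ k \<and> 2 * a n < 1 - x $ k"
          using order_tendstoD(2)[OF lim2] x
          by (intro eventually_all_finite eventually_conj) auto
        then have "\<forall>\<^sub>F n in sequentially. G x $ i $ j * \<psi> n x = G x $ i $ j"
        proof eventually_elim
          case (elim n)
          have "2 * a n \<le> x $ k \<and> x $ k \<le> 1 - 2 * a n" for k using elim[rule_format, of k] by linarith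
          then show ?case using \<psi>(4) by simp
        qed
        then show "(\<lambda>n. G x $ i $ j * \<psi> n x) \<longlonglongrightarrow> G x $ i $ j" by (rule tendsto_eventually)
      qed
    qed (use Gij in auto)
    have "(\<lambda>n. 2 * a n) \<longlonglongrightarrow> 0" using tendsto_mult_left[OF alim, of 2] by simp
    then have "\<forall>\<^sub>F n in sequentially. 2 * a n < \<eta>" using \<open>\<eta> > 0\<close> by (rule order_tendstoD)
    then have "\<forall>\<^sub>F n in sequentially. \<bar>LINT x|?M. G x $ i $ j * \<psi> n x\<bar> \<le> 8 * C * \<delta>"
      by eventually_elim (rule small)
    then show "\<bar>LINT x|?M. G x $ i $ j\<bar> \<le> 8 * C * \<delta>"
      by (intro tendsto_upperbound[OF tendsto_rabs[OF lim]]) auto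
  qed
qed

subsection \<open>Linear maps as test functions\<close>

lemma integrable_compact_support:
  fixes v :: "real ^ 'n::finite \<Rightarrow> real"
  assumes "compact K" "continuous_on UNIV v" "\<And>x. x \<notin> K \<Longrightarrow> v x = 0"
  shows "integrable lborel v"
proof -
  have "integrable lborel (\<lambda>x. indicator K x *\<^sub>R v x)"
    using assms by (intro borel_integrable_compact) (auto intro: continuous_on_subset)
  also have "(\<lambda>x. indicator K x *\<^sub>R v x) = v" using assms(3) by (fastforce simp: indicator_def)
  finally show ?thesis .
qed

text \<open>Extension by zero moves the integrals of the weak gradient identity from the domain to
  the whole space, where translation invariance is available.\<close>

lemma integral_lebesgue_on_support:
  fixes v :: "real ^ 'n::finite \<Rightarrow> real"
  assumes "open \<Omega>" "continuous_on UNIV v" "\<And>x. x \<notin> \<Omega> \<Longrightarrow> v x = 0"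
  shows "(LINT x|lebesgue_on \<Omega>. v x) = (LINT x|lborel. v x)"
proof -
  have "(LINT x|lebesgue_on \<Omega>. v x) = (LINT x|lebesgue. indicator \<Omega> x *\<^sub>R v x)"
    using assms(1) by (intro integral_restrict_space) auto
  also have "(\<lambda>x. indicator \<Omega> x *\<^sub>R v x) = v" using assms(3) by (fastforce simp: indicator_def)
  also have "(LINT x|lebesgue. v x) = (LINT x|lborel. v x)"
    using borel_measurable_continuous_onI[OF assms(2)] by (intro integral_completion) auto
  finally show ?thesis .
qed

lemma partial_eq_0_outside:
  assumes "closed K" "\<And>x. x \<notin> K \<Longrightarrow> u x = 0" "x \<notin> K"
  shows "partial j u x = 0"
proof -
  have "((\<lambda>_. 0) has_derivative (\<lambda>_. 0)) (at x)" by simp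
  then have "(u has_derivative (\<lambda>_. 0)) (at x)"
    by (rule has_derivative_transform_within_open[of _ _ _ _ "- K"]) (use assms in auto)
  then show ?thesis by (simp add: partial_def flip: frechet_derivative_at)
qed

lemma has_real_derivative_along_axis:
  assumes "\<And>x. u differentiable (at x)"
  shows "((\<lambda>t. u (x + t *\<^sub>R axis j 1)) has_real_derivative partial j u (x + t *\<^sub>R axis j 1)) (at t)"
proof -
  let ?y = "x + t *\<^sub>R axis j 1"
  have u: "(u has_derivative frechet_derivative u (at ?y)) (at ?y)"
    using assms frechet_derivative_works by blast
  have "((\<lambda>t. x + t *\<^sub>R axis j 1) has_derivative (\<lambda>s. s *\<^sub>R axis j 1)) (at t)"
    by (auto intro!: derivative_eq_intros)
  then have "((\<lambda>t. u (x + t *\<^sub>R axis j 1)) has_derivative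
      (\<lambda>s. frechet_derivative u (at ?y) (s *\<^sub>R axis j 1))) (at t)"
    by (rule has_derivative_compose) (rule u)
  moreover have "frechet_derivative u (at ?y) (s *\<^sub>R axis j 1) = partial j u ?y * s" for s
    using linear_scale[OF linear_frechet_derivative[OF assms], of ?y s "axis j 1"]
    by (simp add: partial_def)
  ultimately show ?thesis by (simp add: has_field_derivative_def)
qed

text \<open>The integrals of the difference quotients vanish by translation invariance.\<close>

lemma integral_partial_eq_0:
  fixes u :: "real ^ 'n::finite \<Rightarrow> real"
  assumes diff: "\<And>x. u differentiable (at x)" and cont: "continuous_on UNIV (partial j u)"
    and K: "compact K" and zero: "\<And>x. x \<notin> K \<Longrightarrow> u x = 0"
  shows "(LINT x|lborel. partial j u x) = 0"
proof -
  let ?e = "axis j 1 :: real ^ 'n"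
  define h where "h n = 1 / (real n + 1)" for n
  have h: "0 < h n" "h n \<le> 1" for n by (auto simp: h_def)
  define q where "q n x = (u (x + h n *\<^sub>R ?e) - u x) / h n" for n x
  have contu: "continuous_on UNIV u"
    by (intro continuous_at_imp_continuous_on ballI differentiable_imp_continuous_within diff)
  have int: "integrable lborel u" by (rule integrable_compact_support[OF K contu zero])
  have distr: "distr lborel borel ((+) (h n *\<^sub>R ?e)) = lborel" for n
    by (rule lborel_distr_plus)
  have [measurable]: "u \<in> borel_measurable borel" by (rule borel_measurable_continuous_onI[OF contu])
  have shift: "integrable lborel (\<lambda>x. u (x + h n *\<^sub>R ?e))"
    "(LINT x|lborel. u (x + h n *\<^sub>R ?e)) = (LINT x|lborel. u x)" for n
  proof -
    have "integrable (distr lborel borel ((+) (h n *\<^sub>R ?e))) u" using int by (simp add: distr)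
    then show "integrable lborel (\<lambda>x. u (x + h n *\<^sub>R ?e))"
      by (subst (asm) integrable_distr_eq) (auto simp: add.commute)
    have "(LINT x|lborel. u x) = (LINT x|distr lborel borel ((+) (h n *\<^sub>R ?e)). u x)" by (simp add: distr)
    also have "\<dots> = (LINT x|lborel. u (h n *\<^sub>R ?e + x))" by (rule integral_distr) auto
    finally show "(LINT x|lborel. u (x + h n *\<^sub>R ?e)) = (LINT x|lborel. u x)" by (simp add: add.commute)
  qed
  have q0: "(LINT x|lborel. q n x) = 0" for n
    unfolding q_def using int shift[of n] by simp
  have "bounded (partial j u ` K)"
    using K cont by (intro compact_imp_bounded compact_continuous_image) (auto intro: continuous_on_subset)
  then obtain B0 where B0: "\<And>x. x \<in> K \<Longrightarrow> \<bar>partial j u x\<bar> \<le> B0" unfolding bounded_iff by auto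
  \<comment> \<open>When \<open>K\<close> is empty, \<open>B0\<close> may be negative; the maximum
    also covers points outside \<open>K\<close>, where the derivative is 0.\<close>
  define B where "B = max B0 0"
  have B: "\<bar>partial j u x\<bar> \<le> B" for x
  proof (cases "x \<in> K")
    case False
    have "partial j u x = 0" by (rule partial_eq_0_outside[OF compact_imp_closed[OF K] zero False])
    then show ?thesis by (simp add: B_def)
  qed (use B0 in \<open>force simp: B_def\<close>)
  obtain R where R: "\<And>x. x \<in> K \<Longrightarrow> norm x \<le> R"
    using compact_imp_bounded[OF K] unfolding bounded_iff by auto
  have qlim: "(\<lambda>n. q n x) \<longlonglongrightarrow> partial j u x" for x
  proof -
    have "((\<lambda>t. u (x + t *\<^sub>R ?e)) has_real_derivative partial j u (x + 0 *\<^sub>R ?e)) (at 0)"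
      by (rule has_real_derivative_along_axis) (rule diff)
    then have "((\<lambda>t. (u (x + t *\<^sub>R ?e) - u x) / t) \<longlongrightarrow> partial j u x) (at 0)"
      by (simp add: has_field_derivative_iff)
    moreover have "h \<longlonglongrightarrow> 0" unfolding h_def by real_asymp
    then have "filterlim h (at 0) sequentially"
      using h(1) by (auto simp: filterlim_at intro!: always_eventually) (metis less_irrefl)
    ultimately show ?thesis unfolding q_def by (rule filterlim_compose)
  qed
  \<comment> \<open>By the mean value theorem along the axis, a difference quotient is a value of
    the partial derivative; since \<open>h n \<le> 1\<close>, it vanishes outside the ball of radius
    \<open>R + 1\<close>. This gives one majorant for all \<open>n\<close>.\<close>
  have qbound: "\<bar>q n x\<bar> \<le> B * indicator (cball 0 (R + 1)) x" for n x
  proof (cases "x \<in> cball 0 (R + 1)")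
    case True
    obtain z where "u (x + h n *\<^sub>R ?e) - u (x + 0 *\<^sub>R ?e) = (h n - 0) * partial j u (x + z *\<^sub>R ?e)"
      using MVT2[OF h(1)[of n], of "\<lambda>t. u (x + t *\<^sub>R ?e)" "\<lambda>t. partial j u (x + t *\<^sub>R ?e)"]
        has_real_derivative_along_axis[OF diff] by blast
    then have "q n x = partial j u (x + z *\<^sub>R ?e)" using h(1)[of n] by (simp add: q_def)
    then show ?thesis using B True by simp
  next
    case False
    have "norm x \<le> norm (x + h n *\<^sub>R ?e) + norm (h n *\<^sub>R ?e)"
      using norm_triangle_ineq4[of "x + h n *\<^sub>R ?e" "h n *\<^sub>R ?e"] by simp
    then have "R < norm x" "R < norm (x + h n *\<^sub>R ?e)" using False h[of n] by auto
    then have "x \<notin> K" "x + h n *\<^sub>R ?e \<notin> K" using R by force+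
    then show ?thesis using zero False by (simp add: q_def)
  qed
  have "(\<lambda>n. LINT x|lborel. q n x) \<longlonglongrightarrow> (LINT x|lborel. partial j u x)"
  proof (rule integral_dominated_convergence[where w = "\<lambda>x. B * indicator (cball 0 (R + 1)) x"])
    show "partial j u \<in> borel_measurable lborel"
      using borel_measurable_continuous_onI[OF cont] by simp
    show "q n \<in> borel_measurable lborel" for n unfolding q_def by measurable
    show "integrable lborel (\<lambda>x :: real ^ 'n. B * indicator (cball 0 (R + 1)) x)"
      using emeasure_bounded_finite[OF bounded_cball, of "0 :: real ^ 'n" "R + 1"]
      by (intro integrable_mult_right integrable_real_indicator) auto
  qed (use qlim qbound in auto)
  then show ?thesis using q0 by (simp add: LIMSEQ_const_iff)
qed

text \<open>The product \<open>u\<close> of a linear coordinate function and \<open>\<psi>\<close>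
  has compact support, so the integral of its partial derivative vanishes. The product rule splits
  that integral in two, since \<open>(A *v x) $ i\<close> has derivative \<open>A $ i $ j\<close> in
  direction \<open>j\<close>.\<close>

lemma integral_by_parts_linear:
  fixes A :: "real ^ 'n::finite ^ 'd::finite"
  assumes "open \<Omega>" and \<psi>: "\<psi> \<in> test_functions \<Omega>"
  shows "(LINT x|lebesgue_on \<Omega>. (A *v x) $ i * partial j \<psi> x)
    = - (LINT x|lebesgue_on \<Omega>. A $ i $ j * \<psi> x)"
proof -
  define K where "K = closure {x. \<psi> x \<noteq> 0}"
  have K: "compact K" "K \<subseteq> \<Omega>" and smooth: "smooth \<psi>"
    using \<psi> by (auto simp: test_functions_def K_def)
  have zero: "\<psi> x = 0" if "x \<notin> K" for x using that closure_subset[of "{x. \<psi> x \<noteq> 0}"] by (auto simp: K_def)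
  have zero': "partial j \<psi> x = 0" if "x \<notin> K" for x
    using partial_eq_0_outside[OF compact_imp_closed[OF K(1)] zero that] by simp
  \<comment> \<open>The conditions in \<open>smooth\<close> for the empty list and for
    \<open>[j]\<close> give differentiability of \<open>\<psi>\<close> and of its partial
    derivative.\<close>
  have diff: "\<psi> differentiable (at x)" for x
    using smooth unfolding smooth_def by (metis foldr.simps(1) id_apply)
  have diff': "partial j \<psi> differentiable (at x)" for x
    using smooth[unfolded smooth_def, rule_format, of "[j]" x] by simp
  have cont: "continuous_on UNIV \<psi>" "continuous_on UNIV (partial j \<psi>)"
    by (intro continuous_at_imp_continuous_on ballI differentiable_imp_continuous_within diff diff')+
  have bl: "bounded_linear (\<lambda>x. (A *v x) $ i)"
    using bounded_linear_compose[OF bounded_linear_vec_nth matrix_vector_mul_bounded_linear] .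
  then have contA: "continuous_on UNIV (\<lambda>x. (A *v x) $ i)"
    by (rule linear_continuous_on)
  define u where "u x = (A *v x) $ i * \<psi> x" for x
  have du: "(u has_derivative (\<lambda>h. (A *v x) $ i * frechet_derivative \<psi> (at x) h + (A *v h) $ i * \<psi> x)) (at x)" for x
    unfolding u_def
    by (rule has_derivative_mult[OF bounded_linear_imp_has_derivative[OF bl]])
      (use diff frechet_derivative_works in blast)
  have pu: "partial j u = (\<lambda>x. (A *v x) $ i * partial j \<psi> x + A $ i $ j * \<psi> x)"
    unfolding partial_def
    by (auto simp: fun_eq_iff frechet_derivative_at[OF du, symmetric] matrix_vector_mult_basis column_def)
  have int: "integrable lborel (\<lambda>x. (A *v x) $ i * partial j \<psi> x)" "integrable lborel (\<lambda>x. A $ i $ j * \<psi> x)"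
    by (rule integrable_compact_support[OF K(1)]; use zero zero' in \<open>auto intro!: continuous_intros cont contA\<close>)+
  have "(LINT x|lborel. partial j u x) = 0"
  proof (rule integral_partial_eq_0[OF _ _ K(1)])
    show "u differentiable (at x)" for x using du differentiable_def by blast
    show "continuous_on UNIV (partial j u)" unfolding pu by (intro continuous_intros cont contA)
  qed (simp add: u_def zero)
  then have "(LINT x|lborel. (A *v x) $ i * partial j \<psi> x) = - (LINT x|lborel. A $ i $ j * \<psi> x)"
    using Bochner_Integration.integral_add[OF int] by (simp add: pu)
  moreover have "(LINT x|lebesgue_on \<Omega>. (A *v x) $ i * partial j \<psi> x) = (LINT x|lborel. (A *v x) $ i * partial j \<psi> x)"
    using K(2) zero' by (intro integral_lebesgue_on_support assms continuous_intros cont contA) auto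
  moreover have "(LINT x|lebesgue_on \<Omega>. A $ i $ j * \<psi> x) = (LINT x|lborel. A $ i $ j * \<psi> x)"
    using K(2) zero by (intro integral_lebesgue_on_support assms continuous_intros cont) auto
  ultimately show ?thesis by (simp only:)
qed

section \<open>Linear maps as Sobolev functions with constant gradient\<close>

lemma Linf_norm_le:
  assumes "u \<in> borel_measurable (lebesgue_on \<Omega>)" "\<And>x. x \<in> \<Omega> \<Longrightarrow> norm (u x) \<le> B"
  shows "Linf_norm \<Omega> u \<le> ereal B"
  unfolding Linf_norm_def
  by (rule esssup_I) (use assms in \<open>auto intro!: AE_I2\<close>)

text \<open>Cauchy-Schwarz row by row: the norm of a matrix here is the Frobenius norm, that is, the
  Euclidean norm of the row norms.\<close>

lemma norm_matrix_vector_mult_le: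
  fixes A :: "real ^ 'n::finite ^ 'd::finite"
  shows "norm (A *v x) \<le> norm A * norm x"
proof -
  have "norm (A *v x) \<le> L2_set (\<lambda>i. norm (A $ i) * norm x) UNIV"
    unfolding norm_vec_def[of "A *v x"]
    by (rule L2_set_mono) (auto simp: matrix_vector_mul_component Cauchy_Schwarz_ineq2)
  also have "\<dots> = norm A * norm x"
    by (simp add: norm_vec_def[of A] L2_set_left_distrib)
  finally show ?thesis .
qed

lemma norm_le_CARD_unit_cube:
  fixes x :: "real ^ 'n::finite"
  assumes "x \<in> cbox 0 1"
  shows "norm x \<le> CARD('n)"
proof -
  have "norm x \<le> (\<Sum>i\<in>UNIV. \<bar>x $ i\<bar>)" by (rule norm_le_l1_cart)
  also have "\<dots> \<le> (\<Sum>i\<in>(UNIV :: 'n set). 1)" using assms by (intro sum_mono) (auto simp: mem_box_cart)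
  finally show ?thesis by simp
qed

lemma W1inf_linear:
  fixes A :: "real ^ 'n::finite ^ 'd::finite"
  shows "W1inf unit_cube ((*v) A) (\<lambda>_. A)"
proof -
  let ?Q = "unit_cube :: (real ^ 'n) set"
  have "(*v) A \<in> borel_measurable (lebesgue_on ?Q)"
    by (intro continuous_imp_measurable_on_sets_lebesgue linear_continuous_on
        matrix_vector_mul_bounded_linear) auto
  moreover have "norm (A *v x) \<le> norm A * CARD('n)" if "x \<in> ?Q" for x
    using norm_matrix_vector_mult_le[of A x] norm_le_CARD_unit_cube[of x] that box_subset_cbox
    by (meson mult_left_mono norm_ge_zero order_trans subsetD)
  ultimately have "Linf_norm ?Q ((*v) A) \<le> ereal (norm A * CARD('n))" by (rule Linf_norm_le)
  then have "(*v) A \<in> Linf ?Q"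
    using \<open>(*v) A \<in> borel_measurable _\<close> by (auto simp: Linf_def intro: le_less_trans)
  moreover have "Linf_norm ?Q (\<lambda>_. A) \<le> ereal (norm A)" by (rule Linf_norm_le) auto
  then have "(\<lambda>_. A) \<in> Linf ?Q" by (auto simp: Linf_def intro: le_less_trans)
  ultimately show ?thesis unfolding W1inf_def using integral_by_parts_linear[OF open_box] by blast
qed

section \<open>Strong Morrey quasiconvexity implies lower semicontinuity\<close>

lemma strong_Morrey_quasiconvex_real_lsc:
  fixes g :: "real ^ 'n::finite ^ 'd::finite \<Rightarrow> real"
  assumes "strong_Morrey_quasiconvex_real g" "\<epsilon> > 0"
  shows "\<forall>\<^sub>F \<zeta> in nhds \<xi>. g \<xi> \<le> g \<zeta> + \<epsilon>"
proof -
  let ?Q = "unit_cube :: (real ^ 'n) set"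
  obtain \<delta> where "\<delta> > 0" and \<delta>: "\<forall>\<phi> G. W1inf ?Q \<phi> G \<longrightarrow> continuous_on (closure ?Q) \<phi> \<longrightarrow>
      Linf_norm ?Q G \<le> ereal 1 \<longrightarrow> (\<forall>x\<in>frontier ?Q. norm (\<phi> x) \<le> \<delta>) \<longrightarrow>
      ereal (g \<xi>) \<le> esssup (lebesgue_on ?Q) (\<lambda>x. ereal (g (\<xi> + G x))) + ereal \<epsilon>"
    using assms(1)[unfolded strong_Morrey_quasiconvex_real_def, THEN conjunct2, rule_format,
        OF assms(2) zero_less_one] by blast
  \<comment> \<open>The bound 1 keeps the gradient within the choice \<open>K = 1\<close>; the
    quotient keeps the boundary values of the linear map within \<open>\<delta>\<close>, as points
    of the closed cube have norm at most \<open>CARD('n)\<close>.\<close>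
  define \<eta> where "\<eta> = min 1 (\<delta> / CARD('n))"
  have "\<eta> > 0" using \<open>\<delta> > 0\<close> by (simp add: \<eta>_def)
  have "g \<xi> \<le> g \<zeta> + \<epsilon>" if "dist \<zeta> \<xi> < \<eta>" for \<zeta>
  proof -
    define A where "A = \<zeta> - \<xi>"
    have A: "norm A \<le> 1" "norm A * CARD('n) \<le> \<delta>"
      using that by (auto simp: A_def \<eta>_def dist_norm field_simps)
    have "ereal (g \<xi>) \<le> esssup (lebesgue_on ?Q) (\<lambda>x. ereal (g (\<xi> + A))) + ereal \<epsilon>"
    proof (rule \<delta>[rule_format, OF W1inf_linear])
      show "continuous_on (closure ?Q) ((*v) A)"
        by (intro linear_continuous_on matrix_vector_mul_bounded_linear)
      have "Linf_norm ?Q (\<lambda>_. A) \<le> ereal (norm A)" by (rule Linf_norm_le) auto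
      then show "Linf_norm ?Q (\<lambda>_. A) \<le> ereal 1" using A(1) by (meson ereal_less_eq(3) order_trans)
      show "norm (A *v x) \<le> \<delta>" if "x \<in> frontier ?Q" for x
      proof -
        have "x \<in> cbox 0 1"
          using that closure_minimal[OF box_subset_cbox closed_cbox, of "0 :: real ^ 'n" 1]
          by (auto simp: frontier_def)
        then have "norm A * norm x \<le> norm A * CARD('n)"
          by (intro mult_left_mono norm_le_CARD_unit_cube) auto
        then show "norm (A *v x) \<le> \<delta>" using norm_matrix_vector_mult_le[of A x] A(2) by linarith
      qed
    qed
    \<comment> \<open>Since \<open>\<xi> + A = \<zeta>\<close>, the essential supremum is that of
      the constant \<open>g \<zeta>\<close>.\<close>
    also have "esssup (lebesgue_on ?Q) (\<lambda>x. ereal (g (\<xi> + A))) \<le> ereal (g \<zeta>)"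
      by (rule esssup_I) (auto simp: A_def)
    then have "esssup (lebesgue_on ?Q) (\<lambda>x. ereal (g (\<xi> + A))) + ereal \<epsilon> \<le> ereal (g \<zeta>) + ereal \<epsilon>"
      by (rule add_right_mono)
    finally show ?thesis by simp
  qed
  then show ?thesis using \<open>\<eta> > 0\<close> by (auto simp: eventually_nhds_metric)
qed

lemma strong_Morrey_quasiconvex_imp_lsc:
  assumes "strong_Morrey_quasiconvex g"
  shows "lsc g"
  unfolding lsc_iff_open
proof
  fix y
  have "\<forall>\<^sub>F \<zeta> in nhds \<xi>. \<zeta> \<in> {x. y < g x}" if "y < g \<xi>" for \<xi>
  proof -
    \<comment> \<open>Half the gap between the two arctangents, so that a loss of
      \<open>\<epsilon>\<close> still leaves a value strictly above that of
      \<open>y\<close>.\<close>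
    define \<epsilon> where "\<epsilon> = (arctan_ereal (g \<xi>) - arctan_ereal y) / 2"
    have "\<epsilon> > 0" using that by (simp add: \<epsilon>_def arctan_ereal_less_iff)
    with assms have "\<forall>\<^sub>F \<zeta> in nhds \<xi>. arctan_ereal (g \<xi>) \<le> arctan_ereal (g \<zeta>) + \<epsilon>"
      unfolding strong_Morrey_quasiconvex_def by (intro strong_Morrey_quasiconvex_real_lsc) auto
    then show ?thesis
    proof eventually_elim
      case (elim \<zeta>)
      then have "arctan_ereal y < arctan_ereal (g \<zeta>)"
        using \<open>\<epsilon> > 0\<close> unfolding \<epsilon>_def by (simp add: field_simps)
      then show ?case by (simp add: arctan_ereal_less_iff)
    qed
  qed
  then show "open {x. y < g x}" by (subst open_subopen) (fastforce simp: eventually_nhds)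
qed

subsection \<open>Jensen's inequality for level convex functions\<close>

text \<open>Otherwise a hyperplane strictly separates the mean from \<open>C\<close>; integrating
  the almost sure bound on the normal component puts the mean on the other side.\<close>

lemma (in prob_space) expectation_in_closed_convex:
  fixes X :: "'a \<Rightarrow> 'b::euclidean_space"
  assumes C: "closed C" "convex C" and X: "integrable M X" "AE x in M. X x \<in> C"
  shows "expectation X \<in> C"
proof (rule ccontr)
  assume "expectation X \<notin> C"
  then obtain a b where ab: "a \<bullet> expectation X < b" "\<And>x. x \<in> C \<Longrightarrow> b < a \<bullet> x"
    using separating_hyperplane_closed_point[OF C(2,1)] by blast
  have "AE x in M. b \<le> a \<bullet> X x" using X(2) by eventually_elim (use ab(2) in \<open>auto intro: less_imp_le\<close>)
  then have "b \<le> expectation (\<lambda>x. a \<bullet> X x)"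
    using X(1) by (intro integral_ge_const) auto
  then show False using ab(1) X(1) by simp
qed

lemma norm_matrix_le_sum:
  fixes A :: "real ^ 'n::finite ^ 'd::finite"
  shows "norm A \<le> (\<Sum>i\<in>UNIV. \<Sum>j\<in>UNIV. \<bar>A $ i $ j\<bar>)"
proof -
  have "norm A \<le> (\<Sum>i\<in>UNIV. norm (A $ i))"
    unfolding norm_vec_def[of A] by (rule L2_set_le_sum) simp
  also have "\<dots> \<le> (\<Sum>i\<in>UNIV. \<Sum>j\<in>UNIV. \<bar>A $ i $ j\<bar>)"
    by (intro sum_mono norm_le_l1_cart)
  finally show ?thesis .
qed

lemma lsc_imp_borel_measurable:
  fixes f :: "'a::topological_space \<Rightarrow> ereal"
  assumes "lsc f"
  shows "f \<in> borel_measurable borel"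
  by (rule borel_measurableI_greater) (use assms in \<open>auto simp: lsc_iff_open\<close>)

text \<open>The mean of \<open>\<xi> + G\<close> lies in the closed convex sublevel set at the level
  of the essential supremum, so \<open>g\<close> at this mean is at most that supremum. The mean is
  close to \<open>\<xi>\<close>, where lower semicontinuity loses at most \<open>\<epsilon>\<close>.
  Levels are extended real because the supremum may be infinite.\<close>

lemma strong_Morrey_quasiconvex_realI:
  fixes g :: "real ^ 'n::finite ^ 'd::finite \<Rightarrow> real"
  assumes closed: "\<And>c. closed {x. ereal (g x) \<le> c}" and convex: "\<And>c. convex {x. ereal (g x) \<le> c}"
  shows "strong_Morrey_quasiconvex_real g"
  unfolding strong_Morrey_quasiconvex_real_def
proof (intro conjI allI impI)
  show "g \<in> borel_measurable borel"
    unfolding borel_measurable_iff_le using closed[of "ereal _"] by (auto intro: borel_closed)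
  let ?Q = "unit_cube :: (real ^ 'n) set"
  interpret prob_space "lebesgue_on ?Q" by (rule prob_space_unit_cube)
  fix \<epsilon> :: real and \<xi> :: "real ^ 'n ^ 'd" and K :: real
  assume "\<epsilon> > 0"
  have "open (- {x. ereal (g x) \<le> ereal (g \<xi> - \<epsilon>)})" using closed by (rule open_Compl)
  moreover have "\<xi> \<in> - {x. ereal (g x) \<le> ereal (g \<xi> - \<epsilon>)}" using \<open>\<epsilon> > 0\<close> by simp
  ultimately obtain \<eta> where "\<eta> > 0" and "ball \<xi> \<eta> \<subseteq> - {x. ereal (g x) \<le> ereal (g \<xi> - \<epsilon>)}"
    unfolding open_contains_ball by blast
  then have \<eta>: "g \<xi> - \<epsilon> < g x" if "dist \<xi> x < \<eta>" for x using that by (auto simp: not_le)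
  obtain C :: real where "C > 0" and C:
    "\<And>(\<phi> :: real ^ 'n \<Rightarrow> real ^ 'd) G \<delta> i j.
      W1inf ?Q \<phi> G \<Longrightarrow> continuous_on (closure ?Q) \<phi> \<Longrightarrow> \<delta> > 0 \<Longrightarrow>
      \<forall>x\<in>frontier ?Q. norm (\<phi> x) \<le> \<delta> \<Longrightarrow>
      \<bar>LINT x|lebesgue_on ?Q. G x $ i $ j\<bar> \<le> C * \<delta>"
    by (rule integral_weak_gradient_le) blast
  \<comment> \<open>Each of the \<open>CARD('d) * CARD('n)\<close> entries of the mean gradient is
    at most \<open>C * \<delta>\<close> in absolute value; with this choice these bounds add up to
    \<open>\<eta> / 2\<close>.\<close>
  define \<delta> where "\<delta> = \<eta> / (2 * C * CARD('d) * CARD('n))"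
  have "\<delta> > 0" using \<open>\<eta> > 0\<close> \<open>C > 0\<close> by (simp add: \<delta>_def)
  have "ereal (g \<xi>) \<le> esssup (lebesgue_on ?Q) (\<lambda>x. ereal (g (\<xi> + G x))) + ereal \<epsilon>"
    if W: "W1inf ?Q \<phi> G" and \<phi>: "continuous_on (closure ?Q) \<phi>" "\<forall>x\<in>frontier ?Q. norm (\<phi> x) \<le> \<delta>"
    for \<phi> G
  proof -
    let ?s = "esssup (lebesgue_on ?Q) (\<lambda>x. ereal (g (\<xi> + G x)))"
    have G: "G \<in> Linf ?Q" "G \<in> borel_measurable (lebesgue_on ?Q)" using W by (auto simp: W1inf_def Linf_def)
    obtain B where "AE x in lebesgue_on ?Q. norm (G x) \<le> B" using Linf_AE_bounded[OF G(1)] .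
    then have int: "integrable (lebesgue_on ?Q) G" using G(2) by (intro integrable_const_bound) auto
    have comp: "expectation G $ i $ j = expectation (\<lambda>x. G x $ i $ j)" for i j
    proof -
      have "bounded_linear (\<lambda>A :: real ^ 'n ^ 'd. A $ i $ j)"
        by (rule bounded_linear_compose[OF bounded_linear_vec_nth bounded_linear_vec_nth])
      from integral_bounded_linear[OF this int] show ?thesis by simp
    qed
    have "norm (expectation G) \<le> (\<Sum>i\<in>(UNIV :: 'd set). \<Sum>j\<in>(UNIV :: 'n set). C * \<delta>)"
      using C[OF W \<phi>(1) \<open>\<delta> > 0\<close> \<phi>(2)]
      by (intro order_trans[OF norm_matrix_le_sum] sum_mono) (simp add: comp)
    also have "\<dots> = \<eta> / 2" using \<open>C > 0\<close> by (simp add: \<delta>_def)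
    also have "\<dots> < \<eta>" using \<open>\<eta> > 0\<close> by simp
    finally have near: "g \<xi> - \<epsilon> < g (\<xi> + expectation G)" by (intro \<eta>) (simp add: dist_norm)
    have "AE x in lebesgue_on ?Q. \<xi> + G x \<in> {x. ereal (g x) \<le> ?s}"
      using esssup_AE[of "\<lambda>x. ereal (g (\<xi> + G x))" "lebesgue_on ?Q"] by simp
    then have "expectation (\<lambda>x. \<xi> + G x) \<in> {x. ereal (g x) \<le> ?s}"
      using int by (intro expectation_in_closed_convex closed convex) auto
    moreover have "expectation (\<lambda>x. \<xi> + G x) = \<xi> + expectation G"
      using int prob_space by simp
    ultimately have "ereal (g (\<xi> + expectation G)) \<le> ?s" by simp
    then have "ereal (g (\<xi> + expectation G)) + ereal \<epsilon> \<le> ?s + ereal \<epsilon>" by (rule add_right_mono)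
    moreover have "ereal (g \<xi>) \<le> ereal (g (\<xi> + expectation G)) + ereal \<epsilon>" using near by simp
    ultimately show ?thesis by (rule order_trans[rotated])
  qed
  then show "\<exists>\<delta>>0. \<forall>\<phi> G. W1inf ?Q \<phi> G \<longrightarrow> continuous_on (closure ?Q) \<phi> \<longrightarrow>
      Linf_norm ?Q G \<le> ereal K \<longrightarrow> (\<forall>x\<in>frontier ?Q. norm (\<phi> x) \<le> \<delta>) \<longrightarrow>
      ereal (g \<xi>) \<le> esssup (lebesgue_on ?Q) (\<lambda>x. ereal (g (\<xi> + G x))) + ereal \<epsilon>"
    using \<open>\<delta> > 0\<close> by blast
qed

text \<open>Each sublevel set of the arctangent of the envelope is empty, the whole space or a
  sublevel set of the envelope, hence closed and convex.\<close>

lemma strong_Morrey_quasiconvex_lsc_envelope: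
  fixes f :: "real ^ 'n::finite ^ 'd::finite \<Rightarrow> ereal"
  assumes "level_convex f"
  shows "strong_Morrey_quasiconvex (lsc_envelope f)"
proof -
  have "closed {x. ereal (arctan_ereal (lsc_envelope f x)) \<le> c} \<and>
    convex {x. ereal (arctan_ereal (lsc_envelope f x)) \<le> c}" for c
    using arctan_ereal_sublevel_cases[of "lsc_envelope f" c]
      lsc_imp_closed_le[OF lsc_lsc_envelope, of f] convex_lsc_envelope_le[OF assms] by auto
  then show ?thesis
    unfolding strong_Morrey_quasiconvex_def
    by (intro conjI strong_Morrey_quasiconvex_realI lsc_imp_borel_measurable lsc_lsc_envelope) auto
qed

text \<open>Maximality holds because a strong Morrey quasiconvex minorant of \<open>f\<close> is
  lower semicontinuous and thus lies below the greatest lower semicontinuous minorant.\<close>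

theorem corollary3p5:
  fixes f :: "real ^ 'n::finite ^ 'd::finite \<Rightarrow> ereal"
  assumes "f \<in> borel_measurable borel"
    and "level_convex f"
    and "\<And>l::real. (INF \<xi>. f \<xi>) < ereal l \<Longrightarrow> convex (sublevel f l) \<and> interior (sublevel f l) \<noteq> {}"
  shows "strong_Morrey_quasiconvex (lsc_envelope f) \<and> lsc_envelope f \<le> f \<and>
    (\<forall>g. strong_Morrey_quasiconvex g \<and> g \<le> f \<longrightarrow> g \<le> lsc_envelope f)"
  using strong_Morrey_quasiconvex_lsc_envelope[OF assms(2)] lsc_envelope_le
    strong_Morrey_quasiconvex_imp_lsc lsc_envelope_greatest by blast

end
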